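(* Let $\mu_0=\mathcal N(m_0,\Sigma_0)$ and $\mu_1=\mathcal N(m_1,\Sigma_1)$ with $m_0,m_1\in\mathbb R^n$ and $\Sigma_0,\Sigma_1\succ0$ be an arbitrary ordered pair of points of $\mathcal G$. Then there is a unique $e_1$-geodesic $\gamma_1:[0,1]\to\mathcal G$ and a unique $e_0$-geodesic $\gamma_0:[0,1]\to\mathcal G$ satisfying $\gamma_i(0)=\mu_0$ and $\gamma_i(1)=\mu_1$ for $i\in\{0,1\}$. The $e_1$-geodesic is $$\gamma_1(t)=\mathcal N\bigl(R^tm_0+K_t(A)b,\;R^t\Sigma_0R^t\bigr),\qquad 0\le t\le1,$$ where $$R=\Sigma_0^{-1/2}\bigl(\Sigma_0^{1/2}\Sigma_1\Sigma_0^{1/2}\bigr)^{1/2}\Sigma_0^{-1/2},\qquad A=\log R,\qquad b=K_1(A)^{-1}(m_1-Rm_0),\qquad K_t(A)=\int_0^te^{sA}\,ds,$$ with generator given by the quadratic potential $f(x)=\frac12x^\top Ax+b^\top x$. The $e_0$-geodesic is $$\gamma_0(t)=\mathcal N(P_t^{-1}\eta_t,P_t^{-1}),\qquad P_t=(1-t)\Sigma_0^{-1}+t\Sigma_1^{-1},\qquad \eta_t=(1-t)\Sigma_0^{-1}m_0+t\Sigma_1^{-1}m_1 .$$ Thus both connections are globally geodesically connected on $\mathcal G$, although only the $e_1$-connection is geodesically complete (every $e_1$-geodesic with prescribed initial position and velocity extends to all $t\in\mathbb R$, while this fails for the $e_0$-connection).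
   Context: $S_n$ is the space of real symmetric $n\times n$ matrices, $S_n^+$ the cone of positive definite ones ($n\ge1$). $\mathcal G=\{\mathcal N(m,\Sigma):m\in\mathbb R^n,\Sigma\in S_n^+\}$ is the manifold of nondegenerate Gaussian measures on $\mathbb R^n$ with global chart $(m,\Sigma)$. A tangent vector at $\mu=\mathcal N(m,\Sigma)$ has a coordinate velocity $(m_v,\Sigma_v)\in\mathbb R^n\times S_n$ and is identified with the signed measure $a=g\,\mu$, where $$g(x)=\tfrac12(x-m)^\top\Sigma^{-1}\Sigma_v\Sigma^{-1}(x-m)+m_v^\top\Sigma^{-1}(x-m)-\tfrac12\mathrm{Tr}(\Sigma^{-1}\Sigma_v).$$ For positive definite matrices, $\log$ is the principal symmetric logarithm, square roots are the symmetric positive semidefinite ones, and $R^t=e^{t\log R}$. The $e_0$-connection: its parallel transport from $\mu$ to $\nu$ sends $a\in T_\mu\mathcal G$ to $\bigl(\frac{da}{d\mu}-\mathbb E_\nu[\frac{da}{d\mu}]\bigr)\nu\in T_\nu\mathcal G$. The $e_1$-connection: associate to the tangent vector $(m_v,\Sigma_v)$ at $\mathcal N(m,\Sigma)$ the unique pair $(A,b)\in S_n\times\mathbb R^n$ with $A\Sigma+\Sigma A=\Sigma_v$, $Am+b=m_v$. The $e_1$-parallel transport to $\nu=\mathcal N(m_\nu,\Sigma_\nu)$ sends it to the tangent vector at $\nu$ with coordinate velocity $(Am_\nu+b,\,A\Sigma_\nu+\Sigma_\nu A)$. For $i\in\{0,1\}$, a curve in $\mathcal G$ is an $e_i$-geodesic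 if its velocity at each time $t$ is the $e_i$-parallel transport of its velocity at time $0$ along the pair (initial point, current point). A connection is geodesically complete if every geodesic with prescribed initial position and velocity is defined for all $t\in\mathbb R$. *)

theory Defs
  imports "HOL-Analysis.Analysis"
begin

subsection \<open>Matrix functions\<close>

definition symmetric :: "real^'n^'n \<Rightarrow> bool" where
  "symmetric M \<longleftrightarrow> transpose M = M"

definition posdef :: "real^'n^'n \<Rightarrow> bool" where
  "posdef M \<longleftrightarrow> symmetric M \<and> (\<forall>x. x \<noteq> 0 \<longrightarrow> x \<bullet> (M *v x) > 0)"

definition possemidef :: "real^'n^'n \<Rightarrow> bool" where
  "possemidef M \<longleftrightarrow> symmetric M \<and> (\<forall>x. x \<bullet> (M *v x) \<ge> 0)"

text \<open>The library's multiplication and power on \<open>real^'n^'n\<close> are componentwise and its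
  \<open>exp\<close> does not apply to this type, so powers are iterated \<open>**\<close>.\<close>

definition matrix_power :: "real^'n^'n \<Rightarrow> nat \<Rightarrow> real^'n^'n" where
  "matrix_power M k = (((**) M) ^^ k) (mat 1)"

definition matrix_exp :: "real^'n^'n \<Rightarrow> real^'n^'n" where
  "matrix_exp M = (\<Sum>k. (1 / fact k) *\<^sub>R matrix_power M k)"

definition matrix_sqrt :: "real^'n^'n \<Rightarrow> real^'n^'n" where
  "matrix_sqrt M = (THE S. possemidef S \<and> S ** S = M)"

definition matrix_log :: "real^'n^'n \<Rightarrow> real^'n^'n" where
  "matrix_log M = (THE L. symmetric L \<and> matrix_exp L = M)"

definition matrix_rpow :: "real^'n^'n \<Rightarrow> real \<Rightarrow> real^'n^'n" where
  "matrix_rpow M t = matrix_exp (t *\<^sub>R matrix_log M)"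

definition int_exp :: "real \<Rightarrow> real^'n^'n \<Rightarrow> real^'n^'n" where
  "int_exp t M = integral {0..t} (\<lambda>s. matrix_exp (s *\<^sub>R M))"


subsection \<open>Nondegenerate Gaussian measures and their tangent vectors\<close>

definition gaussian_density :: "real^'n \<Rightarrow> real^'n^'n \<Rightarrow> real^'n \<Rightarrow> real" where
  "gaussian_density m S x =
     exp (- ((x - m) \<bullet> (matrix_inv S *v (x - m))) / 2) / sqrt ((2 * pi) ^ CARD('n) * det S)"

definition gaussian :: "real^'n \<Rightarrow> real^'n^'n \<Rightarrow> (real^'n) measure" where
  "gaussian m S = density lborel (\<lambda>x. ennreal (gaussian_density m S x))"

definition gaussians :: "(real^'n) measure set" where
  "gaussians = {gaussian m S | m S. posdef S}"

definition gauss_chart :: "(real^'n) measure \<Rightarrow> (real^'n) \<times> (real^'n^'n)" where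
  "gauss_chart = inv_into (UNIV \<times> {S. posdef S}) (\<lambda>(m, S). gaussian m S)"

text \<open>A tangent vector is given by its coordinate velocity \<open>(m\<^sub>v, \<Sigma>\<^sub>v)\<close>; its base point is
  passed separately.\<close>

type_synonym 'n tangent = "(real^'n) \<times> (real^'n^'n)"

definition tangent_space :: "'n::finite tangent set" where
  "tangent_space = UNIV \<times> {V. symmetric V}"

text \<open>A finite signed measure on the Borel sets is represented by its set function, extended by
  \<open>0\<close> to nonmeasurable sets. \<open>signed_density \<mu> g\<close> is the signed measure \<open>g \<mu>\<close>, and
  \<open>signed_RN_deriv \<mu> a\<close> is \<open>da/d\<mu>\<close>, determined up to \<open>\<mu>\<close>-null sets (the library's
  \<open>RN_deriv\<close> covers nonnegative measures only).\<close>

type_synonym 'n signed_measure = "(real^'n) set \<Rightarrow> real"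

definition signed_density ::
    "(real^'n) measure \<Rightarrow> (real^'n \<Rightarrow> real) \<Rightarrow> 'n::finite signed_measure" where
  "signed_density \<mu> g = (\<lambda>B. if B \<in> sets \<mu> then set_lebesgue_integral \<mu> B g else 0)"

definition signed_RN_deriv ::
    "(real^'n) measure \<Rightarrow> 'n::finite signed_measure \<Rightarrow> real^'n \<Rightarrow> real" where
  "signed_RN_deriv \<mu> a = (SOME h. integrable \<mu> h \<and> signed_density \<mu> h = a)"

definition tangent_density :: "(real^'n) measure \<Rightarrow> 'n::finite tangent \<Rightarrow> real^'n \<Rightarrow> real" where
  "tangent_density \<mu> w x =
     (let (m, S) = gauss_chart \<mu>; (v, V) = w; Q = matrix_inv S in
        (x - m) \<bullet> ((Q ** V ** Q) *v (x - m)) / 2 + v \<bullet> (Q *v (x - m)) - trace (Q ** V) / 2)"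

definition tangent_measure :: "(real^'n) measure \<Rightarrow> 'n::finite tangent \<Rightarrow> 'n signed_measure" where
  "tangent_measure \<mu> w = signed_density \<mu> (tangent_density \<mu> w)"


subsection \<open>The two connections\<close>

type_synonym 'n parallel_transport =
  "(real^'n) measure \<Rightarrow> (real^'n) measure \<Rightarrow> 'n tangent \<Rightarrow> 'n tangent"

definition e0_transport_measure ::
    "(real^'n) measure \<Rightarrow> (real^'n) measure \<Rightarrow> 'n::finite signed_measure \<Rightarrow> 'n signed_measure" where
  "e0_transport_measure \<mu> \<nu> a =
     (let h = signed_RN_deriv \<mu> a in signed_density \<nu> (\<lambda>x. h x - (\<integral>y. h y \<partial>\<nu>)))"

text \<open>The transported signed measure is read back as a coordinate velocity at \<open>\<nu>\<close>.\<close>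

definition e0_transport :: "'n::finite parallel_transport" where
  "e0_transport \<mu> \<nu> w =
     inv_into tangent_space (tangent_measure \<nu>)
       (e0_transport_measure \<mu> \<nu> (tangent_measure \<mu> w))"

definition e1_generator :: "(real^'n) measure \<Rightarrow> 'n::finite tangent \<Rightarrow> (real^'n^'n) \<times> (real^'n)" where
  "e1_generator \<mu> w =
     (let (m, S) = gauss_chart \<mu>; (v, V) = w in
        THE (A, b). symmetric A \<and> A ** S + S ** A = V \<and> A *v m + b = v)"

definition e1_transport :: "'n::finite parallel_transport" where
  "e1_transport \<mu> \<nu> w =
     (let (A, b) = e1_generator \<mu> w; (m, S) = gauss_chart \<nu> in (A *v m + b, A ** S + S ** A))"


subsection \<open>Geodesics\<close>

text \<open>Velocities are taken within the time interval \<open>T\<close>, so they are one-sided at its endpoints.\<close>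

definition velocity :: "real set \<Rightarrow> (real \<Rightarrow> (real^'n) measure) \<Rightarrow> real \<Rightarrow> 'n::finite tangent" where
  "velocity T \<gamma> t = vector_derivative (gauss_chart \<circ> \<gamma>) (at t within T)"

text \<open>The initial time is \<open>0\<close>; the interval \<open>T\<close> is required to contain it and to be
  nondegenerate, so that derivatives within \<open>T\<close> are unique.\<close>

definition geodesic ::
    "'n::finite parallel_transport \<Rightarrow> real set \<Rightarrow> (real \<Rightarrow> (real^'n) measure) \<Rightarrow> bool" where
  "geodesic tr T \<gamma> \<longleftrightarrow>
     is_interval T \<and> 0 \<in> T \<and> T \<noteq> {0} \<and>
     (\<forall>t\<in>T. \<gamma> t \<in> gaussians \<and>
        (gauss_chart \<circ> \<gamma>) differentiable (at t within T) \<and>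
        velocity T \<gamma> t = tr (\<gamma> 0) (\<gamma> t) (velocity T \<gamma> 0))"

definition geodesic_between ::
    "'n::finite parallel_transport \<Rightarrow> (real^'n) measure \<Rightarrow> (real^'n) measure \<Rightarrow>
     (real \<Rightarrow> (real^'n) measure) \<Rightarrow> bool" where
  "geodesic_between tr \<mu> \<nu> \<gamma> \<longleftrightarrow> geodesic tr {0..1} \<gamma> \<and> \<gamma> 0 = \<mu> \<and> \<gamma> 1 = \<nu>"

definition geodesically_connected :: "'n::finite parallel_transport \<Rightarrow> bool" where
  "geodesically_connected tr \<longleftrightarrow>
     (\<forall>\<mu>\<in>gaussians. \<forall>\<nu>\<in>gaussians. \<exists>\<gamma>. geodesic_between tr \<mu> \<nu> \<gamma>)"

definition geodesically_complete :: "'n::finite parallel_transport \<Rightarrow> bool" where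
  "geodesically_complete tr \<longleftrightarrow>
     (\<forall>\<mu>\<in>gaussians. \<forall>w\<in>tangent_space.
        \<exists>\<gamma>. geodesic tr UNIV \<gamma> \<and> \<gamma> 0 = \<mu> \<and> velocity UNIV \<gamma> 0 = w)"

definition geodesics_extend :: "'n::finite parallel_transport \<Rightarrow> bool" where
  "geodesics_extend tr \<longleftrightarrow>
     (\<forall>T \<gamma>. geodesic tr T \<gamma> \<longrightarrow> (\<exists>\<gamma>'. geodesic tr UNIV \<gamma>' \<and> (\<forall>t\<in>T. \<gamma>' t = \<gamma> t)))"

end

theory Submission
  imports Defs "HOL-Probability.Distributions"
begin

text \<open>
  In the chart \<open>(m, \<Sigma>)\<close> both geodesic conditions become differential equations that can be solved in
  closed form.

  For the e1-connection the generator \<open>(A, b)\<close> of the velocity is constant in time, so the curve solves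
  \<open>m' = A m + b\<close> and \<open>\<Sigma>' = A \<Sigma> + \<Sigma> A\<close>. This linear system has the global solution
  \<open>m\<^sub>t = e\<^sup>t\<^sup>A m\<^sub>0 + K\<^sub>t b\<close>, \<open>\<Sigma>\<^sub>t = e\<^sup>t\<^sup>A \<Sigma>\<^sub>0 e\<^sup>t\<^sup>A\<close>, and no other (\<open>e1_geodesicI\<close>, \<open>e1_geodesic_explicit\<close>), which
  gives completeness. Reaching \<open>\<Sigma>\<^sub>1\<close> at time 1 means \<open>e\<^sup>A \<Sigma>\<^sub>0 e\<^sup>A = \<Sigma>\<^sub>1\<close>; among positive definite matrices
  this congruence has exactly one solution, the matrix \<open>R\<close> (\<open>posdef_transport_matrix\<close>), so \<open>A = log R\<close>.
  As \<open>K\<^sub>1\<close> is positive definite, \<open>b\<close> is then determined by the means.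

  For the e0-connection, transport changes the score of a tangent vector, its density with respect to
  the base measure, only by a constant (\<open>e0_transport_eqI\<close>). The score is a quadratic polynomial whose
  quadratic and linear coefficients are the velocities of \<open>- \<Sigma>\<^sup>-\<^sup>1 / 2\<close> and of \<open>\<Sigma>\<^sup>-\<^sup>1 m\<close>. So e0-geodesics are exactly the curves along
  which \<open>\<Sigma>\<^sup>-\<^sup>1\<close> and \<open>\<Sigma>\<^sup>-\<^sup>1 m\<close> are affine in time (\<open>e0_geodesicI\<close>, \<open>e0_geodesic_explicit\<close>). Segments stay in
  the cone of positive definite matrices since it is convex, which gives connectedness and the formula;
  rays may leave it, as \<open>(1 - t) I\<close> does at \<open>t = 1\<close>, which is why completeness fails.

  Two bodies of facts support this. Square roots, logarithms and exponentials of symmetric matrices come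
  from the spectral theorem, their uniqueness from \<open>functional_calculus_inj\<close>. That the
  constant in the score is the one that makes its mean zero rests on the first two moments of Gaussian
  measures (\<open>gaussian_quadratic\<close>), obtained from the standard Gaussian by a linear substitution
  that uses the invariance of Lebesgue measure under orthogonal maps.\<close>

section \<open>Matrix products, inverses and definiteness\<close>

lemma bounded_bilinear_matrix_matrix_mult:
  "bounded_bilinear (\<lambda>(A::real^'n^'n) (B::real^'n^'n). A ** B)"
  by (simp add: bilinear_conv_bounded_bilinear[symmetric] bilinear_def linear_iff
      matrix_add_ldistrib matrix_matrix_mult_def vec_eq_iff sum.distrib algebra_simps
      sum_distrib_left sum_distrib_right)

lemma bounded_bilinear_matrix_vector_mult:
  "bounded_bilinear (\<lambda>(A::real^'n^'n) (x::real^'n). A *v x)"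
  by (simp add: bilinear_conv_bounded_bilinear[symmetric] bilinear_def linear_iff
      algebra_simps scaleR_matrix_vector_assoc)

lemmas has_vector_derivative_matrix_mult =
  bounded_bilinear.has_vector_derivative[OF bounded_bilinear_matrix_matrix_mult]
lemmas has_vector_derivative_matrix_vector_mult =
  bounded_bilinear.has_vector_derivative[OF bounded_bilinear_matrix_vector_mult]

lemma bounded_linear_transpose: "bounded_linear (transpose :: real^'n^'n \<Rightarrow> real^'n^'n)"
  by (simp add: linear_conv_bounded_linear[symmetric] linear_iff transpose_def vec_eq_iff)

lemma transpose_add: "transpose (A + B) = transpose A + transpose (B :: real^'n^'n)"
  by (simp add: transpose_def vec_eq_iff)

lemma inner_matrix_vector_transpose: "x \<bullet> (A *v y) = (transpose A *v x) \<bullet> (y :: real^'n)"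
  by (simp add: dot_lmul_matrix)

lemma symmetric_inner: "symmetric A \<Longrightarrow> x \<bullet> (A *v y) = (A *v x) \<bullet> (y :: real^'n)"
  by (metis inner_matrix_vector_transpose symmetric_def)

lemma matrix_inv_unique:
  fixes A :: "real^'n^'n"
  assumes "A ** B = mat 1"
  shows "matrix_inv A = B"
proof -
  have BA: "B ** A = mat 1"
    using assms by (simp add: matrix_left_right_inverse)
  have "A ** matrix_inv A = mat 1 \<and> matrix_inv A ** A = mat 1"
    unfolding matrix_inv_def by (rule someI[of _ B]) (simp add: assms BA)
  then show ?thesis
    by (metis BA matrix_mul_assoc matrix_mul_lid matrix_mul_rid)
qed

lemma matrix_inv_mat_1: "matrix_inv (mat 1 :: real^'n^'n) = mat 1"
  by (rule matrix_inv_unique) simp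

lemma matrix_inv_inverse:
  fixes A :: "real^'n^'n"
  assumes "invertible A"
  shows "A ** matrix_inv A = mat 1" "matrix_inv A ** A = mat 1"
  using assms matrix_inv_unique unfolding invertible_def by metis+

lemma posdef_symmetric: "posdef S \<Longrightarrow> symmetric S"
  by (simp add: posdef_def)

lemma posdef_imp_possemidef: "posdef S \<Longrightarrow> possemidef S"
  by (metis inner_zero_left order_less_imp_le order_refl posdef_def possemidef_def)

lemma posdef_invertible:
  fixes S :: "real^'n^'n"
  assumes "posdef S"
  shows "invertible S"
proof -
  have "x = 0" if "S *v x = 0" for x
    using assms that unfolding posdef_def by (metis inner_zero_right less_irrefl)
  then show ?thesis
    by (simp add: invertible_left_inverse matrix_left_invertible_ker)
qed

lemmas posdef_inv = matrix_inv_inverse[OF posdef_invertible]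

lemma posdef_inv_mult_left: "posdef S \<Longrightarrow> S ** (matrix_inv S ** X) = X"
  and posdef_inv_mult_right: "posdef S \<Longrightarrow> matrix_inv S ** (S ** X) = X"
  by (simp_all add: matrix_mul_assoc posdef_inv)

lemma posdef_inv_vec_left: "posdef S \<Longrightarrow> S *v (matrix_inv S *v x) = x"
  and posdef_inv_vec_right: "posdef S \<Longrightarrow> matrix_inv S *v (S *v x) = x"
  by (simp_all add: matrix_vector_mul_assoc posdef_inv)

lemma symmetric_sandwich:
  "symmetric X \<Longrightarrow> symmetric S \<Longrightarrow> symmetric (X ** S ** X)"
  by (simp add: symmetric_def matrix_transpose_mul matrix_mul_assoc)

lemma posdef_sandwich:
  fixes X S :: "real^'n^'n"
  assumes "symmetric X" "invertible X" "posdef S"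
  shows "posdef (X ** S ** X)"
proof -
  have "x \<bullet> ((X ** S ** X) *v x) = (X *v x) \<bullet> (S *v (X *v x))" for x
    by (simp add: symmetric_inner[OF assms(1)] flip: matrix_vector_mul_assoc)
  moreover have "X *v x \<noteq> 0" if "x \<noteq> 0" for x
    using that assms(2) by (metis invertible_left_inverse matrix_left_invertible_ker)
  ultimately show ?thesis
    using assms by (simp add: posdef_def symmetric_sandwich)
qed

lemma symmetric_matrix_inv:
  fixes S :: "real^'n^'n"
  assumes "symmetric S" "invertible S"
  shows "symmetric (matrix_inv S)"
proof -
  have "S ** transpose (matrix_inv S) = transpose (matrix_inv S ** S)"
    using assms(1) by (simp add: matrix_transpose_mul symmetric_def)
  also have "\<dots> = mat 1"
    using assms(2) by (simp add: matrix_inv_inverse)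
  finally show ?thesis
    using matrix_inv_unique by (metis symmetric_def)
qed

lemma posdef_matrix_inv:
  fixes S :: "real^'n^'n"
  assumes "posdef S"
  shows "posdef (matrix_inv S)"
proof -
  have "invertible (matrix_inv S)"
    using posdef_inv[OF assms] unfolding invertible_def by blast
  moreover have "matrix_inv S ** S ** matrix_inv S = matrix_inv S"
    using assms by (simp add: posdef_inv)
  ultimately show ?thesis
    using assms posdef_sandwich[of "matrix_inv S" S]
    by (simp add: symmetric_matrix_inv posdef_symmetric posdef_invertible)
qed

lemma matrix_inv_matrix_inv:
  fixes S :: "real^'n^'n"
  shows "posdef S \<Longrightarrow> matrix_inv (matrix_inv S) = S"
  by (simp add: matrix_inv_unique posdef_inv)

lemma symmetric_add: "symmetric A \<Longrightarrow> symmetric B \<Longrightarrow> symmetric (A + B)"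
  by (simp add: symmetric_def transpose_add)

lemma symmetric_scaleR: "symmetric A \<Longrightarrow> symmetric (c *\<^sub>R A)"
  by (simp add: symmetric_def transpose_scalar)

lemma symmetric_uminus: "symmetric A \<Longrightarrow> symmetric (- A)"
  using symmetric_scaleR[of A "-1"] by simp

lemma posdef_convex_combination:
  fixes A B :: "real^'n^'n"
  assumes "posdef A" "posdef B" "t \<in> {0..1}"
  shows "posdef ((1 - t) *\<^sub>R A + t *\<^sub>R B)"
proof -
  have "x \<bullet> (((1 - t) *\<^sub>R A + t *\<^sub>R B) *v x) > 0" if "x \<noteq> 0" for x
  proof -
    have *: "x \<bullet> (A *v x) > 0" "x \<bullet> (B *v x) > 0"
      using assms that by (auto simp: posdef_def)
    have "(1 - t) * (x \<bullet> (A *v x)) + t * (x \<bullet> (B *v x)) > 0"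
    proof (cases "t = 0")
      case False
      then show ?thesis
        using * assms(3) by (intro add_nonneg_pos mult_nonneg_nonneg mult_pos_pos) auto
    qed (use * in auto)
    then show ?thesis
      by (simp add: matrix_vector_mult_add_rdistrib inner_add_right flip: scaleR_matrix_vector_assoc)
  qed
  then show ?thesis
    using assms by (simp add: posdef_def symmetric_add symmetric_scaleR)
qed

lemma matrix_eqI: "(\<And>x. A *v x = B *v x) \<Longrightarrow> A = (B :: real^'n^'n)"
  by (simp add: matrix_eq)

text \<open>Polarisation: the difference of the two forms vanishes on \<open>x\<close>, \<open>y\<close> and \<open>x + y\<close>, hence so does its
  bilinear form.\<close>

lemma symmetric_quadratic_form_unique:
  fixes A B :: "real^'n^'n"
  assumes "symmetric A" "symmetric B" "\<And>x. x \<bullet> (A *v x) = x \<bullet> (B *v x)"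
  shows "A = B"
proof -
  let ?C = "A - B"
  have q: "x \<bullet> (?C *v x) = 0" for x
    using assms(3) by (simp add: matrix_vector_mult_diff_rdistrib inner_diff_right)
  have sym: "x \<bullet> (?C *v y) = (?C *v x) \<bullet> y" for x y
    using symmetric_inner[OF assms(1)] symmetric_inner[OF assms(2)]
    by (simp add: matrix_vector_mult_diff_rdistrib inner_diff_right inner_diff_left)
  have "?C *v x = 0" for x
  proof -
    have "(x + y) \<bullet> (?C *v (x + y)) = x \<bullet> (?C *v x) + y \<bullet> (?C *v y) + 2 * (y \<bullet> (?C *v x))" for y
      using sym[of x y] inner_commute[of y "?C *v x"]
      by (simp add: matrix_vector_right_distrib inner_add_left inner_add_right
          del: matrix_vector_mult_diff_rdistrib)
    then have "y \<bullet> (?C *v x) = 0" for y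
      by (simp add: q)
    then show ?thesis
      using inner_eq_zero_iff by blast
  qed
  then show ?thesis
    by (intro matrix_eqI) (simp add: matrix_vector_mult_diff_rdistrib)
qed

text \<open>Cramer's rule makes every entry of the inverse a quotient of polynomials in the entries of
  the matrix; this is where continuity of inversion comes from.\<close>

lemma tendsto_matrix_inv:
  fixes S :: "'a \<Rightarrow> real^'n^'n"
  assumes "(S \<longlongrightarrow> S0) F" "invertible S0" "\<forall>\<^sub>F t in F. invertible (S t)"
  shows "((\<lambda>t. matrix_inv (S t)) \<longlongrightarrow> matrix_inv S0) F"
proof -
  have entry: "matrix_inv M $ k $ l = det (\<chi> i j. if j = k then axis l 1 $ i else M$i$j) / det M"
    if "invertible M" for M :: "real^'n^'n" and k l
  proof -
    have "M *v (matrix_inv M *v axis l 1) = axis l 1"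
      by (simp add: matrix_vector_mul_assoc matrix_inv_inverse that)
    then have "matrix_inv M *v axis l 1
        = (\<chi> k. det (\<chi> i j. if j = k then axis l 1 $ i else M$i$j) / det M)"
      using that by (simp add: cramer invertible_det_nz)
    then show ?thesis
      by (simp add: vec_eq_iff matrix_vector_mul_component inner_axis) 
  qed
  have ent: "((\<lambda>t. S t $ i $ j) \<longlongrightarrow> S0 $ i $ j) F" for i j
    using assms(1) by (intro tendsto_vec_nth)
  have det_lim: "((\<lambda>t. det (M t)) \<longlongrightarrow> det M0) F"
    if "\<And>i j. ((\<lambda>t. M t $ i $ j) \<longlongrightarrow> M0 $ i $ j) F" for M :: "'a \<Rightarrow> real^'n^'n" and M0
    unfolding det_def by (intro tendsto_sum tendsto_mult tendsto_const tendsto_prod that)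
  let ?q = "\<lambda>M k l. det (\<chi> i j. if j = k then axis l 1 $ i else M$i$j) / det M"
  have "((\<lambda>t. ?q (S t) k l) \<longlongrightarrow> ?q S0 k l) F" for k l
    using assms(2) by (intro tendsto_divide det_lim) (auto simp: ent invertible_det_nz)
  then have "((\<lambda>t. \<chi> k l. ?q (S t) k l) \<longlongrightarrow> (\<chi> k l. ?q S0 k l)) F"
    by (intro vec_tendstoI) simp
  moreover have "matrix_inv M = (\<chi> k l. ?q M k l)" if "invertible M" for M :: "real^'n^'n"
    using that by (simp add: vec_eq_iff entry)
  ultimately show ?thesis
    using assms(2,3) by (auto elim!: Lim_transform_eventually eventually_mono)
qed

lemma has_vector_derivative_iff_quotient:
  "(f has_vector_derivative D) (at t within T) \<longleftrightarrow>
    ((\<lambda>s. (f s - f t) /\<^sub>R (s - t)) \<longlongrightarrow> D) (at t within T)"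
proof -
  have "norm (f s - f t - (s - t) *\<^sub>R D) / norm (s - t) = norm ((f s - f t) /\<^sub>R (s - t) - D)"
    if "s \<noteq> t" for s
  proof -
    have "(f s - f t) /\<^sub>R (s - t) - D = (f s - f t - (s - t) *\<^sub>R D) /\<^sub>R (s - t)"
      using that by (simp add: scaleR_diff_right)
    then show ?thesis
      by (simp add: divide_inverse_commute)
  qed
  then have "(f has_vector_derivative D) (at t within T) \<longleftrightarrow>
    ((\<lambda>s. norm ((f s - f t) /\<^sub>R (s - t) - D)) \<longlongrightarrow> 0) (at t within T)"
    unfolding has_vector_derivative_def has_derivative_iff_norm
    by (simp add: bounded_linear_scaleR_left cong: Lim_cong_within)
  then show ?thesis
    by (simp add: tendsto_norm_zero_iff LIM_zero_iff)
qed

text \<open>From \<open>S\<^sub>s\<^sup>-\<^sup>1 (S\<^sub>s - S\<^sub>t) S\<^sub>t\<^sup>-\<^sup>1 = S\<^sub>t\<^sup>-\<^sup>1 - S\<^sub>s\<^sup>-\<^sup>1\<close>, once continuity of the inverse is known.\<close>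

lemma has_vector_derivative_matrix_inv:
  fixes S :: "real \<Rightarrow> real^'n^'n"
  assumes S: "(S has_vector_derivative S') (at t within T)"
    and inv: "\<And>t. t \<in> T \<Longrightarrow> invertible (S t)" and t: "t \<in> T"
  shows "((\<lambda>t. matrix_inv (S t)) has_vector_derivative
           - (matrix_inv (S t) ** S' ** matrix_inv (S t))) (at t within T)"
proof -
  have cont: "(S \<longlongrightarrow> S t) (at t within T)"
    using has_vector_derivative_continuous[OF S] by (simp add: continuous_within)
  have evT: "\<forall>\<^sub>F s in at t within T. s \<in> T \<and> s \<noteq> t"
    by (auto simp: eventually_at_topological)
  have inv_lim: "((\<lambda>s. matrix_inv (S s)) \<longlongrightarrow> matrix_inv (S t)) (at t within T)"
    by (rule tendsto_matrix_inv[OF cont inv[OF t]]) (use evT inv in \<open>auto elim: eventually_mono\<close>)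
  have "((\<lambda>s. - (matrix_inv (S s) ** ((S s - S t) /\<^sub>R (s - t)) ** matrix_inv (S t)))
      \<longlongrightarrow> - (matrix_inv (S t) ** S' ** matrix_inv (S t))) (at t within T)"
    using S unfolding has_vector_derivative_iff_quotient
    by (intro tendsto_minus bounded_bilinear.tendsto[OF bounded_bilinear_matrix_matrix_mult]
        inv_lim tendsto_const)
  moreover have "- (matrix_inv (S s) ** ((S s - S t) /\<^sub>R (s - t)) ** matrix_inv (S t))
      = (matrix_inv (S s) - matrix_inv (S t)) /\<^sub>R (s - t)" if "s \<in> T" for s
  proof -
    interpret bounded_bilinear "\<lambda>(A::real^'n^'n) (B::real^'n^'n). A ** B"
      by (rule bounded_bilinear_matrix_matrix_mult)
    have "matrix_inv (S s) ** (S s - S t) ** matrix_inv (S t)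
        = matrix_inv (S s) ** S s ** matrix_inv (S t) - matrix_inv (S s) ** (S t ** matrix_inv (S t))"
      by (simp add: diff_left diff_right matrix_mul_assoc)
    also have "\<dots> = matrix_inv (S t) - matrix_inv (S s)"
      by (simp add: matrix_inv_inverse inv that t)
    finally show ?thesis
      by (simp add: scaleR_left scaleR_right flip: scaleR_minus_right)
  qed
  ultimately show ?thesis
    unfolding has_vector_derivative_iff_quotient
    by (elim Lim_transform_eventually) (use evT in \<open>auto elim: eventually_mono\<close>)
qed

section \<open>Spectral theorem and functional calculus\<close>

text \<open>A maximiser of the Rayleigh quotient on the unit sphere of \<open>W\<close> is an eigenvector.\<close>

lemma symmetric_eigenvector_in_invariant_subspace:
  fixes A :: "real^'n^'n"
  assumes A: "symmetric A" and W: "subspace W" "W \<noteq> {0}"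
    and inv: "\<And>x. x \<in> W \<Longrightarrow> A *v x \<in> W"
  obtains x c where "x \<in> W" "norm x = 1" "A *v x = c *\<^sub>R x"
proof -
  let ?K = "W \<inter> sphere 0 1"
  have "compact ?K"
    using closed_subspace[OF W(1)] by (intro closed_Int_compact) auto
  moreover have "?K \<noteq> {}"
  proof -
    obtain w where "w \<in> W" "w \<noteq> 0"
      using W subspace_0 by blast
    then have "(1 / norm w) *\<^sub>R w \<in> ?K"
      using W(1) by (simp add: subspace_scale)
    then show ?thesis by blast
  qed
  moreover have "continuous_on ?K (\<lambda>x. x \<bullet> (A *v x))"
    by (intro continuous_on_inner continuous_on_id linear_continuous_on
        matrix_vector_mul_bounded_linear)
  ultimately have "\<exists>x\<in>?K. \<forall>y\<in>?K. y \<bullet> (A *v y) \<le> x \<bullet> (A *v x)"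
    by (rule continuous_attains_sup)
  then obtain x where x: "x \<in> ?K" and mx: "\<And>y. y \<in> ?K \<Longrightarrow> y \<bullet> (A *v y) \<le> x \<bullet> (A *v x)"
    by blast
  define c where "c = x \<bullet> (A *v x)"
  define q where "q y = c * (y \<bullet> y) - y \<bullet> (A *v y)" for y
  have xW: "x \<in> W" and xx: "x \<bullet> x = 1"
    using x by (auto simp: dot_square_norm)
  have q_nonneg: "q y \<ge> 0" if "y \<in> W" for y
  proof (cases "y = 0")
    case False
    define u where "u = (1 / norm y) *\<^sub>R y"
    have "u \<in> ?K"
      using that False W(1) by (simp add: u_def subspace_scale)
    then have "u \<bullet> (A *v u) \<le> c"
      using mx c_def by blast
    moreover have "u \<bullet> (A *v u) = (y \<bullet> (A *v y)) / (y \<bullet> y)"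
      by (simp add: u_def matrix_vector_mult_scaleR dot_square_norm power2_eq_square)
    ultimately show ?thesis
      using False by (simp add: q_def field_simps)
  qed (simp add: q_def)
  \<comment> \<open>The form \<open>q\<close> is nonnegative on \<open>W\<close> and vanishes at the maximiser, so its first variation
    there is zero; test it in the direction of the residual.\<close>
  define r where "r = c *\<^sub>R x - A *v x"
  have rW: "r \<in> W"
    using W(1) xW inv by (simp add: r_def subspace_diff subspace_scale)
  have exp: "q (x + t *\<^sub>R r) = 2 * t * (r \<bullet> r) + t\<^sup>2 * q r" for t
  proof -
    have "q (x + t *\<^sub>R r) = q x + 2 * t * (c * (r \<bullet> x) - r \<bullet> (A *v x)) + t\<^sup>2 * q r"
      using symmetric_inner[OF A, of x r] inner_commute[of "A *v x" r] inner_commute[of x r]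
      by (simp add: q_def matrix_vector_right_distrib matrix_vector_mult_scaleR inner_add_left
          inner_add_right power2_eq_square algebra_simps)
    moreover have "q x = 0"
      by (simp add: q_def c_def xx)
    moreover have "c * (r \<bullet> x) - r \<bullet> (A *v x) = r \<bullet> r"
      by (simp add: r_def inner_diff_right inner_diff_left algebra_simps)
    ultimately show ?thesis by simp
  qed
  have "r \<bullet> r = 0"
  proof (rule ccontr)
    assume "r \<bullet> r \<noteq> 0"
    then have pos: "r \<bullet> r > 0"
      by (simp add: order_less_le)
    \<comment> \<open>The minimiser of \<open>2 t (r \<bullet> r) + t\<^sup>2 q r\<close>, with \<open>1 + q r\<close> in place of \<open>q r\<close> so that the
      denominator is positive.\<close>
    define t where "t = - (r \<bullet> r) / (1 + q r)"
    have qr: "q r \<ge> 0" by (rule q_nonneg[OF rW])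
    have "x + t *\<^sub>R r \<in> W"
      using W(1) xW rW by (simp add: subspace_add subspace_scale)
    then have "0 \<le> t * (2 * (r \<bullet> r) + t * q r)"
      using q_nonneg[of "x + t *\<^sub>R r"] by (simp add: exp power2_eq_square algebra_simps)
    moreover have "t < 0"
      using pos qr by (simp add: t_def divide_neg_pos)
    moreover have "2 * (r \<bullet> r) + t * q r > 0"
      using pos qr by (auto simp: t_def field_simps intro!: add_nonneg_pos)
    ultimately show False
      using mult_neg_pos by fastforce
  qed
  then have "A *v x = c *\<^sub>R x"
    by (simp add: r_def)
  then show ?thesis
    using that x by auto
qed

text \<open>This is \<open>U diag(d) U\<^sup>T\<close>; for orthogonal \<open>U\<close> the columns of \<open>U\<close> are eigenvectors with
  eigenvalues \<open>d\<close>. It is written as a sum of multiples of fixed rank-one matrices so that limits and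
  derivatives can be taken eigenvalue by eigenvalue.\<close>

definition spectral :: "real^'n^'n \<Rightarrow> ('n \<Rightarrow> real) \<Rightarrow> real^'n^'n" where
  "spectral U d = (\<Sum>i\<in>UNIV. d i *\<^sub>R (\<chi> a b. U$a$i * U$b$i))"

lemma spectral_nth: "spectral U d $ a $ b = (\<Sum>i\<in>UNIV. d i * (U$a$i * U$b$i))"
  by (simp add: spectral_def)

lemma orthogonal_columns_sum:
  assumes "orthogonal_matrix (U::real^'n^'n)"
  shows "(\<Sum>a\<in>UNIV. U$a$i * U$a$j) = (if i = j then 1 else 0)"
proof -
  have "(transpose U ** U) $ i $ j = mat 1 $ i $ j"
    using assms by (simp add: orthogonal_matrix_def)
  then show ?thesis
    by (simp add: matrix_matrix_mult_def transpose_def mat_def)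
qed

lemma spectral_vector: "spectral U d *v x = (\<Sum>i\<in>UNIV. (d i * (column i U \<bullet> x)) *\<^sub>R column i U)"
proof -
  have "(\<Sum>b\<in>UNIV. (\<Sum>i\<in>UNIV. d i * (U$a$i * U$b$i)) * x$b)
      = (\<Sum>i\<in>UNIV. d i * (\<Sum>b\<in>UNIV. U$b$i * x$b) * U$a$i)" for a
    by (simp add: sum_distrib_left sum_distrib_right mult_ac) (rule sum.swap)
  then show ?thesis
    by (simp add: vec_eq_iff matrix_vector_mult_def spectral_nth inner_vec_def column_def)
qed

lemma spectral_eq_conjugated_diagonal:
  "spectral U d = U ** (\<chi> i j. if i = j then d i else 0) ** transpose U"
  by (simp add: vec_eq_iff spectral_nth matrix_matrix_mult_def transpose_def if_distrib
      sum_distrib_left mult_ac cong: if_cong)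

lemma orthogonal_cancel:
  fixes U X :: "real^'n^'n"
  assumes "orthogonal_matrix U"
  shows "U ** (transpose U ** X) = X" "transpose U ** (U ** X) = X"
    "U ** transpose U = mat 1" "transpose U ** U = mat 1"
  using assms by (simp_all add: matrix_mul_assoc orthogonal_matrix_def)

lemma spectral_mult:
  assumes "orthogonal_matrix U"
  shows "spectral U d ** spectral U e = spectral U (\<lambda>i. d i * e i)"
proof -
  have D: "(\<chi> i j. if i = j then d i else 0) ** (\<chi> i j. if i = j then e i else 0)
      = (\<chi> i j. if i = j then d i * e i else (0::real))"
  proof -
    have "(if i = k then d i else 0) * (if k = j then e k else 0)
        = (if k = i then (if i = j then d i * e i else 0) else 0)" for i j k
      by simp
    then show ?thesis
      by (simp add: vec_eq_iff matrix_matrix_mult_def)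
  qed
  show ?thesis
    unfolding spectral_eq_conjugated_diagonal D[symmetric]
    by (simp add: orthogonal_cancel[OF assms] flip: matrix_mul_assoc)
qed

lemma spectral_one: "orthogonal_matrix U \<Longrightarrow> spectral U (\<lambda>_. 1) = mat 1"
  unfolding spectral_eq_conjugated_diagonal mat_def[symmetric]
  by (simp add: orthogonal_matrix_def)

lemma symmetric_spectral: "symmetric (spectral U d)"
  by (simp add: symmetric_def transpose_def vec_eq_iff spectral_nth mult_ac)

lemma scaleR_spectral: "c *\<^sub>R spectral U d = spectral U (\<lambda>i. c * d i)"
  by (simp add: spectral_def scaleR_sum_right)

lemma spectral_quadratic_form: "x \<bullet> (spectral U d *v x) = (\<Sum>i\<in>UNIV. d i * (column i U \<bullet> x)\<^sup>2)"
  by (simp add: spectral_vector inner_sum_right inner_commute power2_eq_square mult_ac)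

lemma column_quadratic_form:
  assumes "orthogonal_matrix U"
  shows "column i U \<bullet> (spectral U d *v column i U) = d i"
proof -
  have "column j U \<bullet> column i U = (if j = i then 1 else 0)" for j
    using orthogonal_columns_sum[OF assms, of j i] by (simp add: column_def inner_vec_def)
  then show ?thesis
    by (simp add: spectral_quadratic_form if_distrib[of "\<lambda>x. x\<^sup>2"]
        if_distrib[of "\<lambda>x. _ * x"] cong: if_cong)
qed

lemma column_nonzero: "orthogonal_matrix (U::real^'n^'n) \<Longrightarrow> column i U \<noteq> 0"
proof
  assume "orthogonal_matrix U" "column i U = 0"
  then show False
    using column_quadratic_form[of U i "\<lambda>_. 1"] by simp
qed

lemma spectral_posdef_iff:
  assumes U: "orthogonal_matrix U"
  shows "posdef (spectral U d) \<longleftrightarrow> (\<forall>i. d i > 0)"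
proof
  assume pd: "posdef (spectral U d)"
  show "\<forall>i. d i > 0"
  proof
    fix i
    have "column i U \<bullet> (spectral U d *v column i U) > 0"
      using pd column_nonzero[OF U, of i] by (simp add: posdef_def)
    then show "d i > 0"
      by (simp only: column_quadratic_form[OF U])
  qed
next
  assume d: "\<forall>i. d i > 0"
  have "x \<bullet> (spectral U d *v x) > 0" if "x \<noteq> 0" for x
  proof -
    have "x = (\<Sum>i\<in>UNIV. (column i U \<bullet> x) *\<^sub>R column i U)"
      using spectral_vector[of U "\<lambda>_. 1" x] by (simp add: spectral_one[OF U])
    moreover have "(\<Sum>i\<in>UNIV. (column i U \<bullet> x) *\<^sub>R column i U) = 0"
      if "\<forall>i. column i U \<bullet> x = 0"
      using that by simp
    ultimately have "\<not> (\<forall>i. column i U \<bullet> x = 0)"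
      using that by argo
    then obtain i where "column i U \<bullet> x \<noteq> 0"
      by blast
    then show ?thesis
      using d unfolding spectral_quadratic_form
      by (intro sum_pos2[of _ i]) (auto simp: less_imp_le)
  qed
  then show "posdef (spectral U d)"
    by (simp add: posdef_def symmetric_spectral)
qed

lemma det_spectral:
  assumes "orthogonal_matrix U"
  shows "det (spectral U d) = (\<Prod>i\<in>UNIV. d i)"
proof -
  have "det U * det U = 1"
    using det_orthogonal_matrix[OF assms] by auto
  then have c: "det U * c * det U = c" for c
    by (metis mult.assoc mult.commute mult.left_neutral)
  have "det (\<chi> i j. if i = j then d i else 0) = (\<Prod>i\<in>UNIV. d i)"
    by (subst det_diagonal) simp_all
  then show ?thesis
    by (simp only: spectral_eq_conjugated_diagonal det_mul det_transpose c)
qed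

text \<open>Take a largest orthonormal set of eigenvectors. Its orthogonal complement is invariant; were it
  nonzero, an eigenvector inside it would enlarge the set.\<close>

lemma spectral_theorem:
  fixes A :: "real^'n^'n"
  assumes A: "symmetric A"
  obtains U d where "orthogonal_matrix U" "A = spectral U d"
proof -
  define good where "good B \<longleftrightarrow> finite B \<and> pairwise orthogonal B \<and>
    (\<forall>x\<in>B. norm x = 1 \<and> (\<exists>c. A *v x = c *\<^sub>R x))" for B
  have indep: "independent B" if "good B" for B
  proof -
    have "0 \<notin> B" using that by (auto simp: good_def)
    then show ?thesis
      using that pairwise_orthogonal_independent by (auto simp: good_def)
  qed
  have bound: "card B \<le> CARD('n)" if "good B" for B
    using independent_card_le[OF indep[OF that]] by simp
  have "good {}" by (simp add: good_def)
  then obtain B where B: "good B" and mx: "\<And>C. good C \<Longrightarrow> card C \<le> card B"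
    using ex_has_greatest_nat[of good "{}" card "Suc CARD('n)"] bound by (metis less_Suc_eq_le)
  define W where "W = {x. \<forall>b\<in>B. b \<bullet> x = 0}"
  have W: "subspace W"
    by (simp add: subspace_def W_def inner_add_right)
  have "W = {0}"
  proof (rule ccontr)
    assume "W \<noteq> {0}"
    moreover have "A *v x \<in> W" if "x \<in> W" for x
    proof -
      have "b \<bullet> (A *v x) = 0" if "b \<in> B" for b
        using B that \<open>x \<in> W\<close> symmetric_inner[OF A, of b x] by (auto simp: good_def W_def)
      then show ?thesis by (simp add: W_def)
    qed
    ultimately obtain x c where x: "x \<in> W" "norm x = 1" "A *v x = c *\<^sub>R x"
      using symmetric_eigenvector_in_invariant_subspace[OF A W] by blast
    have "x \<notin> B"
      using x by (auto simp: W_def norm_eq_1)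
    moreover have "good (insert x B)"
      using B x by (auto simp: good_def W_def pairwise_insert orthogonal_def inner_commute)
    ultimately show False
      using mx[of "insert x B"] B by (simp add: good_def)
  qed
  have "span B = UNIV"
  proof (rule ccontr)
    assume "span B \<noteq> UNIV"
    then obtain a where "a \<noteq> 0" "\<forall>x\<in>span B. a \<bullet> x = 0"
      using span_not_univ_subset_hyperplane[of B] by blast
    then have "a \<in> W"
      by (auto simp: W_def inner_commute span_base)
    then show False
      using \<open>W = {0}\<close> \<open>a \<noteq> 0\<close> by simp
  qed
  then have "card B = CARD('n)"
    using indep[OF B] basis_card_eq_dim[of B UNIV] by simp
  then obtain f where f: "bij_betw f (UNIV::'n set) B"
    using B by (metis finite_class.finite_UNIV finite_same_card_bij good_def)
  define U where "U = (\<chi> a i. f i $ a)"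
  have col: "column i U = f i" for i
    by (simp add: U_def column_def vec_eq_iff)
  have fB: "f i \<in> B" for i
    using f by (auto simp: bij_betw_def)
  have "orthogonal (f i) (f j)" if "i \<noteq> j" for i j
  proof -
    have "f i \<noteq> f j"
      using f that by (auto simp: bij_betw_def inj_on_def)
    then show ?thesis
      using B fB by (auto simp: good_def pairwise_def)
  qed
  then have orth: "orthogonal_matrix U"
    using B fB unfolding orthogonal_matrix_orthonormal_columns col good_def by auto
  have "\<forall>i. \<exists>c. A *v f i = c *\<^sub>R f i"
    using B fB unfolding good_def by blast
  then obtain d where d: "\<And>i. A *v f i = d i *\<^sub>R f i"
    by metis
  have "A *v x = spectral U d *v x" for x
  proof -
    have "x = (\<Sum>i\<in>UNIV. (f i \<bullet> x) *\<^sub>R f i)"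
      using spectral_vector[of U "\<lambda>_. 1" x] by (simp add: spectral_one[OF orth] col)
    then have "A *v x = A *v (\<Sum>i\<in>UNIV. (f i \<bullet> x) *\<^sub>R f i)"
      by (rule arg_cong)
    also have "\<dots> = (\<Sum>i\<in>UNIV. (d i * (f i \<bullet> x)) *\<^sub>R f i)"
      by (simp add: linear_sum[OF matrix_vector_mul_linear] matrix_vector_mult_scaleR d mult.commute)
    finally show ?thesis
      by (simp add: spectral_vector col)
  qed
  then have "A = spectral U d"
    by (rule matrix_eqI)
  then show ?thesis
    by (rule that[OF orth])
qed

lemma posdef_spectral:
  fixes S :: "real^'n^'n"
  assumes "posdef S"
  obtains U d where "orthogonal_matrix U" "\<forall>i. d i > 0" "S = spectral U d"
proof -
  obtain U d where U: "orthogonal_matrix U" "S = spectral U d"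
    using spectral_theorem[OF posdef_symmetric[OF assms]] .
  then have d: "\<forall>i. d i > 0"
    using assms by (simp add: spectral_posdef_iff)
  show ?thesis
    by (rule that[OF U(1) d U(2)])
qed

lemma det_posdef_pos:
  fixes S :: "real^'n^'n"
  assumes "posdef S"
  shows "det S > 0"
proof -
  obtain U d where U: "orthogonal_matrix U" "\<forall>i. d i > 0" "S = spectral U d"
    by (rule posdef_spectral[OF assms])
  show ?thesis
    unfolding U(3) det_spectral[OF U(1)] by (intro prod_pos) (simp add: U(2))
qed

text \<open>A matrix intertwining the two spectral decompositions couples only equal values of \<open>f\<close>,
  hence only equal eigenvalues. This gives uniqueness of square roots and logarithms alike.\<close>

lemma functional_calculus_inj:
  fixes U W :: "real^'n^'n"
  assumes U: "orthogonal_matrix U" and W: "orthogonal_matrix W"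
    and eq: "spectral U (\<lambda>i. f (d i)) = spectral W (\<lambda>i. f (e i))"
    and inj: "inj_on f (range d \<union> range e)"
  shows "spectral U d = spectral W e"
proof -
  define X where "X = transpose W ** U"
  let ?D = "\<lambda>d. (\<chi> i j. if i = j then d i else 0) :: real^'n^'n"
  have inter: "X ** ?D g = ?D h ** X \<longleftrightarrow> spectral U g = spectral W h" for g h
  proof
    assume "X ** ?D g = ?D h ** X"
    then have "W ** (transpose W ** U ** ?D g) ** transpose U = W ** (?D h ** (transpose W ** U)) ** transpose U"
      by (simp add: X_def)
    moreover have "W ** (transpose W ** U ** ?D g) ** transpose U = spectral U g"
      by (simp add: orthogonal_cancel[OF W] spectral_eq_conjugated_diagonal flip: matrix_mul_assoc)
    moreover have "W ** (?D h ** (transpose W ** U)) ** transpose U = spectral W h"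
      by (simp add: orthogonal_cancel[OF U] spectral_eq_conjugated_diagonal flip: matrix_mul_assoc)
    ultimately show "spectral U g = spectral W h" by simp
  next
    assume "spectral U g = spectral W h"
    then have "transpose W ** spectral U g ** U = transpose W ** spectral W h ** U"
      by simp
    moreover have "transpose W ** spectral U g ** U = X ** ?D g"
      by (simp add: X_def spectral_eq_conjugated_diagonal orthogonal_cancel[OF U]
          flip: matrix_mul_assoc)
    moreover have "transpose W ** spectral W h ** U = ?D h ** X"
      by (simp add: X_def spectral_eq_conjugated_diagonal orthogonal_cancel[OF W]
          flip: matrix_mul_assoc)
    ultimately show "X ** ?D g = ?D h ** X" by simp
  qed
  have entries: "X ** ?D g = ?D h ** X \<longleftrightarrow> (\<forall>i j. X$i$j * g j = h i * X$i$j)" for g h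
    by (simp add: vec_eq_iff matrix_matrix_mult_def if_distrib[of "\<lambda>x. _ * x"]
        if_distrib[of "\<lambda>x. x * _"] cong: if_cong)
  have "X ** ?D (\<lambda>i. f (d i)) = ?D (\<lambda>i. f (e i)) ** X"
    by (rule iffD2[OF inter eq])
  then have *: "\<forall>i j. X$i$j * f (d j) = f (e i) * X$i$j"
    by (rule iffD1[OF entries])
  have "X$i$j * d j = e i * X$i$j" for i j
  proof (cases "X$i$j = 0")
    case False
    then have "f (d j) = f (e i)"
      using *[rule_format, of i j] by simp
    then have "d j = e i"
      by (rule inj_onD[OF inj]) auto
    then show ?thesis by simp
  qed simp
  then have "X ** ?D d = ?D e ** X"
    by (intro iffD2[OF entries]) blast
  then show ?thesis
    by (rule iffD1[OF inter])
qed

section \<open>Square roots, exponentials and logarithms\<close>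

lemma possemidef_spectral_nonneg:
  assumes "possemidef (spectral U d)" "orthogonal_matrix U"
  shows "d i \<ge> 0"
proof -
  have "column i U \<bullet> (spectral U d *v column i U) \<ge> 0"
    using assms(1) by (simp add: possemidef_def)
  then show ?thesis
    by (simp only: column_quadratic_form[OF assms(2)])
qed

lemma possemidef_sqrt_unique:
  fixes S T :: "real^'n^'n"
  assumes S: "possemidef S" and T: "possemidef T" and eq: "S ** S = T ** T"
  shows "S = T"
proof -
  obtain U d where U: "orthogonal_matrix U" "S = spectral U d"
    using S spectral_theorem possemidef_def by metis
  obtain W e where W: "orthogonal_matrix W" "T = spectral W e"
    using T spectral_theorem possemidef_def by metis
  have nn: "d i \<ge> 0" "e i \<ge> 0" for i
    using S T U W possemidef_spectral_nonneg by metis+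
  have "inj_on (\<lambda>x. x * x) (range d \<union> range e)"
    by (rule inj_onI) (use nn in \<open>auto simp: power2_eq_square[symmetric] power2_eq_iff_nonneg\<close>)
  then show ?thesis
    using functional_calculus_inj[of U W "\<lambda>x. x * x" d e] U W eq by (simp add: spectral_mult)
qed

lemma matrix_sqrt_eqI: "possemidef T \<Longrightarrow> T ** T = S \<Longrightarrow> matrix_sqrt S = T"
  unfolding matrix_sqrt_def by (rule the_equality) (auto intro: possemidef_sqrt_unique)

lemma posdef_matrix_sqrt:
  fixes S :: "real^'n^'n"
  assumes "posdef S"
  shows "posdef (matrix_sqrt S)" "matrix_sqrt S ** matrix_sqrt S = S"
proof -
  obtain U d where U: "orthogonal_matrix U" "\<forall>i. d i > 0" "S = spectral U d"
    by (rule posdef_spectral[OF assms])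
  let ?T = "spectral U (\<lambda>i. sqrt (d i))"
  have T: "posdef ?T" "?T ** ?T = S"
    using U by (simp_all add: spectral_posdef_iff spectral_mult less_imp_le)
  then have "matrix_sqrt S = ?T"
    by (intro matrix_sqrt_eqI posdef_imp_possemidef)
  then show "posdef (matrix_sqrt S)" "matrix_sqrt S ** matrix_sqrt S = S"
    using T by simp_all
qed

lemma matrix_power_spectral:
  "orthogonal_matrix U \<Longrightarrow> matrix_power (spectral U d) k = spectral U (\<lambda>i. d i ^ k)"
  by (induction k) (simp_all add: matrix_power_def spectral_one spectral_mult)

lemma matrix_exp_spectral:
  assumes "orthogonal_matrix U"
  shows "matrix_exp (spectral U d) = spectral U (\<lambda>i. exp (d i))"
proof -
  have "(\<lambda>k. spectral U (\<lambda>i. d i ^ k /\<^sub>R fact k)) sums spectral U (\<lambda>i. exp (d i))"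
    unfolding spectral_def by (intro sums_sum sums_scaleR_left exp_converges)
  then show ?thesis
    unfolding matrix_exp_def matrix_power_spectral[OF assms] scaleR_spectral
    by (simp add: sums_iff divide_inverse_commute)
qed

lemma matrix_log_eqI:
  fixes L :: "real^'n^'n"
  assumes "symmetric L" "matrix_exp L = M"
  shows "matrix_log M = L"
  unfolding matrix_log_def
proof (rule the_equality)
  fix L' assume L': "symmetric L' \<and> matrix_exp L' = M"
  obtain U d where U: "orthogonal_matrix U" "L = spectral U d"
    using spectral_theorem[OF assms(1)] by blast
  obtain W e where W: "orthogonal_matrix W" "L' = spectral W e"
    using spectral_theorem L' by blast
  show "L' = L"
    using functional_calculus_inj[of W U exp e d] U W assms(2) L'
    by (simp add: matrix_exp_spectral inj_on_def)
qed (use assms in simp)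

lemma matrix_log_posdef:
  fixes R :: "real^'n^'n"
  assumes "posdef R"
  shows "symmetric (matrix_log R)" "matrix_exp (matrix_log R) = R"
proof -
  obtain U d where U: "orthogonal_matrix U" "\<forall>i. d i > 0" "R = spectral U d"
    by (rule posdef_spectral[OF assms])
  let ?L = "spectral U (\<lambda>i. ln (d i))"
  have L: "symmetric ?L" "matrix_exp ?L = R"
    using U by (simp_all add: symmetric_spectral matrix_exp_spectral)
  then have "matrix_log R = ?L"
    by (rule matrix_log_eqI)
  then show "symmetric (matrix_log R)" "matrix_exp (matrix_log R) = R"
    using L by simp_all
qed

section \<open>The flow of a linear vector field\<close>

lemma posdef_matrix_exp: "symmetric A \<Longrightarrow> posdef (matrix_exp (A::real^'n^'n))"
  by (elim spectral_theorem) (simp add: matrix_exp_spectral spectral_posdef_iff)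

lemma matrix_exp_zero: "matrix_exp (0::real^'n^'n) = mat 1"
proof -
  have I: "orthogonal_matrix (mat 1 :: real^'n^'n)"
    by (rule orthogonal_matrix_id)
  have "spectral (mat 1 :: real^'n^'n) (\<lambda>_. 0) = 0"
    by (simp add: spectral_def)
  then show ?thesis
    using matrix_exp_spectral[OF I, of "\<lambda>_. 0"] spectral_one[OF I] by simp
qed

lemma matrix_exp_neg:
  fixes A :: "real^'n^'n"
  assumes "symmetric A"
  shows "matrix_exp (- (t *\<^sub>R A)) ** matrix_exp (t *\<^sub>R A) = mat 1"
proof -
  obtain U d where U: "orthogonal_matrix U" "A = spectral U d"
    using spectral_theorem[OF assms] by blast
  have "- (t *\<^sub>R A) = spectral U (\<lambda>i. - t * d i)" "t *\<^sub>R A = spectral U (\<lambda>i. t * d i)"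
    using scaleR_spectral[of "-t" U d] scaleR_spectral[of t U d] by (simp_all add: U)
  then show ?thesis
    by (simp add: matrix_exp_spectral spectral_mult spectral_one U(1) flip: exp_add)
qed

lemma matrix_exp_commute:
  fixes A :: "real^'n^'n"
  assumes "symmetric A"
  shows "matrix_exp (t *\<^sub>R A) ** A = A ** matrix_exp (t *\<^sub>R A)"
proof -
  obtain U d where U: "orthogonal_matrix U" "A = spectral U d"
    using spectral_theorem[OF assms] by blast
  then show ?thesis
    by (simp add: scaleR_spectral matrix_exp_spectral spectral_mult mult.commute)
qed

lemma has_vector_derivative_spectral:
  assumes "\<And>i. ((\<lambda>t. d t i) has_real_derivative d' i) (at t within T)"
  shows "((\<lambda>t. spectral U (d t)) has_vector_derivative spectral U d') (at t within T)"
  unfolding spectral_def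
  by (intro has_vector_derivative_sum has_vector_derivative_eq_rhs[OF has_vector_derivative_scaleR[OF assms has_vector_derivative_const]])
     simp

lemma has_vector_derivative_matrix_exp:
  fixes A :: "real^'n^'n"
  assumes "symmetric A"
  shows "((\<lambda>t. matrix_exp (t *\<^sub>R A)) has_vector_derivative A ** matrix_exp (t *\<^sub>R A)) (at t within T)"
proof -
  obtain U d where U: "orthogonal_matrix U" "A = spectral U d"
    using spectral_theorem[OF assms] by blast
  have "((\<lambda>t. spectral U (\<lambda>i. exp (t * d i))) has_vector_derivative
      spectral U (\<lambda>i. d i * exp (t * d i))) (at t within T)"
    by (rule has_vector_derivative_spectral) (auto intro!: derivative_eq_intros)
  then show ?thesis
    using U by (simp add: scaleR_spectral matrix_exp_spectral spectral_mult)
qed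

text \<open>The matrix \<open>A\<close> may be singular, so the antiderivative of \<open>exp (t A)\<close> cannot be written as
  \<open>A\<^sup>-\<^sup>1 (exp (t A) - I)\<close>. The last clause is the form of that identity which survives, and it is what makes
  \<open>exp (t A) m + K t b\<close> a solution of \<open>m' = A m + b\<close>.\<close>

definition exp_antiderivative :: "real^'n^'n \<Rightarrow> (real \<Rightarrow> real^'n^'n) \<Rightarrow> bool" where
  "exp_antiderivative A K \<longleftrightarrow> K 0 = 0 \<and>
     (\<forall>t T. (K has_vector_derivative matrix_exp (t *\<^sub>R A)) (at t within T)) \<and>
     (\<forall>t. A ** K t = matrix_exp (t *\<^sub>R A) - mat 1)"

text \<open>The integral over \<open>{0..t}\<close> vanishes for \<open>t < 0\<close>, so \<open>int_exp\<close> is an antiderivative of the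
  exponential only on the half line; on an eigenvector with eigenvalue \<open>c \<noteq> 0\<close> the antiderivative
  on the whole line is multiplication by \<open>(exp (t * c) - 1) / c\<close>. At \<open>t = 1\<close> this is positive, hence
  invertibility.\<close>

lemma exp_antiderivative_exists:
  fixes A :: "real^'n^'n"
  assumes "symmetric A"
  obtains K where "exp_antiderivative A K" "\<forall>t\<ge>0. int_exp t A = K t" "invertible (K 1)"
proof -
  obtain U d where U: "orthogonal_matrix U" "A = spectral U d"
    using spectral_theorem[OF assms] by blast
  define \<phi> where "\<phi> c t = (if c = 0 then t else (exp (t * c) - 1) / c)" for c t :: real
  define K where "K t = spectral U (\<lambda>i. \<phi> (d i) t)" for t
  have \<phi>': "(\<phi> c has_real_derivative exp (t * c)) (at t within T)" for c t T
    by (cases "c = 0") (auto simp: \<phi>_def[abs_def] intro!: derivative_eq_intros)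
  have K0: "K 0 = 0"
    by (simp add: K_def \<phi>_def spectral_def cong: if_cong)
  have K': "(K has_vector_derivative matrix_exp (t *\<^sub>R A)) (at t within T)" for t T
    using has_vector_derivative_spectral[of "\<lambda>t i. \<phi> (d i) t", OF \<phi>']
    by (simp add: K_def[abs_def] U scaleR_spectral matrix_exp_spectral)
  have int: "int_exp t A = K t" if "t \<ge> 0" for t
    using fundamental_theorem_of_calculus[OF that K'] K0
    by (simp add: int_exp_def integral_unique)
  have AK: "A ** K t = matrix_exp (t *\<^sub>R A) - mat 1" for t
  proof -
    have "d i * \<phi> (d i) t = exp (t * d i) - 1" for i
      by (simp add: \<phi>_def)
    then have "A ** K t = spectral U (\<lambda>i. exp (t * d i) - 1)"
      by (simp add: U K_def spectral_mult)
    also have "\<dots> = spectral U (\<lambda>i. exp (t * d i)) - spectral U (\<lambda>_. 1)"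
      by (simp add: spectral_def scaleR_diff_left sum_subtractf)
    finally show ?thesis
      using U by (simp add: scaleR_spectral matrix_exp_spectral spectral_one)
  qed
  have "\<phi> c 1 > 0" for c
    by (cases "c > 0") (auto simp: \<phi>_def divide_neg_neg)
  then have "posdef (K 1)"
    using U by (simp add: K_def spectral_posdef_iff)
  then have "invertible (K 1)"
    by (rule posdef_invertible)
  moreover have "exp_antiderivative A K"
    unfolding exp_antiderivative_def using K0 K' AK by blast
  moreover have "\<forall>t\<ge>0. int_exp t A = K t"
    using int by blast
  ultimately show ?thesis
    using that by blast
qed

section \<open>Linear substitutions in Lebesgue integrals\<close>

lemma measurable_matrix_vector_mult [measurable]:
  "(\<lambda>x. A *v x) \<in> borel_measurable (borel :: (real^'n) measure)" for A :: "real^'n^'n"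
  by (intro borel_measurable_continuous_onI linear_continuous_on matrix_vector_mul_bounded_linear)

lemma nn_integral_lborel_translate:
  fixes g :: "'a::euclidean_space \<Rightarrow> ennreal"
  assumes [measurable]: "g \<in> borel_measurable borel"
  shows "(\<integral>\<^sup>+x. g (c + x) \<partial>lborel) = (\<integral>\<^sup>+x. g x \<partial>lborel)"
proof -
  have "(\<integral>\<^sup>+x. g x \<partial>distr lborel borel ((+) c)) = (\<integral>\<^sup>+x. g (c + x) \<partial>lborel)"
    by (rule nn_integral_distr) simp_all
  then show ?thesis
    by (simp add: lborel_distr_plus)
qed

text \<open>The uniqueness argument for Haar measure, with the unit ball \<open>B\<close> as test set: in the double
  integral of \<open>1\<^sub>B(x) g(U y)\<close> translate \<open>y\<close> by \<open>U\<^sup>T x\<close>, interchange, translate \<open>x\<close> by \<open>- U y\<close>,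
  interchange, and translate \<open>y\<close> back. What remains is the integral of \<open>g\<close> times the volume of the
  ball, because \<open>B\<close> is invariant under \<open>U\<close> and under reflection.\<close>

lemma nn_integral_lborel_orthogonal:
  fixes U :: "real^'n^'n" and g :: "real^'n \<Rightarrow> ennreal"
  assumes U: "orthogonal_matrix U" and [measurable]: "g \<in> borel_measurable borel"
  shows "(\<integral>\<^sup>+x. g (U *v x) \<partial>lborel) = (\<integral>\<^sup>+x. g x \<partial>lborel)"
proof -
  define B :: "(real^'n) set" where "B = ball 0 1"
  define I :: "real^'n \<Rightarrow> ennreal" where "I = indicator B"
  have [measurable]: "B \<in> sets borel" by (simp add: B_def)
  have [measurable]: "I \<in> borel_measurable borel" by (simp add: I_def)
  define V where "V = transpose U"
  have UV: "U *v (V *v x + y) = x + U *v y" for x y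
    by (simp add: V_def matrix_vector_right_distrib matrix_vector_mul_assoc orthogonal_cancel[OF U]
        del: transpose_matrix_vector)
  have norm_U: "norm (U *v y) = norm y" for y
  proof -
    have "(U *v y) \<bullet> (U *v y) = (transpose U *v (U *v y)) \<bullet> y"
      by (rule inner_matrix_vector_transpose)
    also have "\<dots> = y \<bullet> y"
      by (simp add: matrix_vector_mul_assoc orthogonal_cancel[OF U] del: transpose_matrix_vector)
    finally show ?thesis
      by (simp add: norm_eq)
  qed
  have "emeasure lborel B * (\<integral>\<^sup>+y. g (U *v y) \<partial>lborel)
      = (\<integral>\<^sup>+x. \<integral>\<^sup>+y. I x * g (U *v y) \<partial>lborel \<partial>lborel)"
    by (simp add: nn_integral_cmult nn_integral_multc I_def)
  also have "\<dots> = (\<integral>\<^sup>+x. \<integral>\<^sup>+y. I x * g (x + U *v y) \<partial>lborel \<partial>lborel)"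
  proof (rule nn_integral_cong)
    fix x
    show "(\<integral>\<^sup>+y. I x * g (U *v y) \<partial>lborel) = (\<integral>\<^sup>+y. I x * g (x + U *v y) \<partial>lborel)"
      by (subst nn_integral_lborel_translate[of _ "V *v x", symmetric]) (simp_all add: UV)
  qed
  also have "\<dots> = (\<integral>\<^sup>+y. \<integral>\<^sup>+x. I x * g (x + U *v y) \<partial>lborel \<partial>lborel)"
    by (rule lborel_pair.Fubini') simp
  also have "\<dots> = (\<integral>\<^sup>+y. \<integral>\<^sup>+x. I (x - U *v y) * g x \<partial>lborel \<partial>lborel)"
  proof (rule nn_integral_cong)
    fix y
    show "(\<integral>\<^sup>+x. I x * g (x + U *v y) \<partial>lborel) = (\<integral>\<^sup>+x. I (x - U *v y) * g x \<partial>lborel)"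
      by (subst nn_integral_lborel_translate[of _ "- (U *v y)", symmetric]) simp_all
  qed
  also have "\<dots> = (\<integral>\<^sup>+x. \<integral>\<^sup>+y. I (x - U *v y) * g x \<partial>lborel \<partial>lborel)"
    by (rule lborel_pair.Fubini') simp
  also have "\<dots> = (\<integral>\<^sup>+x. \<integral>\<^sup>+y. I y * g x \<partial>lborel \<partial>lborel)"
  proof (rule nn_integral_cong)
    fix x
    have "I (x - U *v (V *v x + y)) = I y" for y
      by (simp add: UV I_def B_def norm_U indicator_def)
    then show "(\<integral>\<^sup>+y. I (x - U *v y) * g x \<partial>lborel) = (\<integral>\<^sup>+y. I y * g x \<partial>lborel)"
      by (subst nn_integral_lborel_translate[of _ "V *v x", symmetric]) simp_all
  qed
  also have "\<dots> = emeasure lborel B * (\<integral>\<^sup>+x. g x \<partial>lborel)"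
    by (simp add: nn_integral_cmult nn_integral_multc I_def)
  finally have eq: "emeasure lborel B * (\<integral>\<^sup>+y. g (U *v y) \<partial>lborel)
      = emeasure lborel B * (\<integral>\<^sup>+x. g x \<partial>lborel)" .
  have "emeasure lborel B \<noteq> 0"
  proof
    assume "emeasure lborel B = 0"
    then have "measure lborel B = 0" by (simp add: measure_def)
    then show False
      using content_ball_pos[of 1 "0::real^'n"] by (simp add: B_def)
  qed
  moreover have "emeasure lborel B \<noteq> top"
    using emeasure_lborel_ball_finite[of "0::real^'n" 1] by (simp add: B_def)
  ultimately show ?thesis
    using eq by (simp add: ennreal_mult_cancel_left)
qed

lemma Basis_vec_real: "(Basis :: (real^'n) set) = range (\<lambda>i. axis i 1)"
  by (auto simp: Basis_vec_def)

lemma inj_axis: "inj (\<lambda>i. axis i (1::real) :: real^'n)"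
  by (auto simp: inj_on_def axis_eq_axis)

lemma prod_Basis_vec: "(\<Prod>b\<in>(Basis :: (real^'n) set). f b) = (\<Prod>i\<in>UNIV. f (axis i 1))"
  by (simp add: Basis_vec_real prod.reindex[OF inj_axis])

lemma sum_Basis_vec_nth: "(\<Sum>b\<in>(Basis :: (real^'n) set). f b *\<^sub>R b) $ i = f (axis i 1)"
proof -
  have "(\<Sum>b\<in>(Basis :: (real^'n) set). f b *\<^sub>R b) = (\<Sum>k\<in>UNIV. f (axis k 1) *\<^sub>R axis k 1)"
    by (simp add: Basis_vec_real sum.reindex[OF inj_axis])
  moreover have "f (axis k 1) * axis k 1 $ i = (if k = i then f (axis i 1) else 0)" for k
    by (simp add: axis_def)
  ultimately show ?thesis
    by simp
qed

lemma nn_integral_lborel_diagonal: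
  fixes g :: "real^'n \<Rightarrow> ennreal" and s :: "'n \<Rightarrow> real"
  assumes [measurable]: "g \<in> borel_measurable borel" and s: "\<And>i. s i > 0"
  shows "(\<integral>\<^sup>+x. g x \<partial>lborel) = ennreal (\<Prod>i\<in>UNIV. s i) * (\<integral>\<^sup>+x. g (\<chi> i. s i * x$i) \<partial>lborel)"
proof -
  define c :: "real^'n \<Rightarrow> real" where "c b = (\<Sum>i\<in>UNIV. s i * b$i)" for b
  have c: "c (axis i 1) = s i" for i
    by (simp add: c_def axis_def if_distrib cong: if_cong)
  let ?T = "\<lambda>x::real^'n. 0 + (\<Sum>b\<in>Basis. (c b * (x \<bullet> b)) *\<^sub>R b)"
  have T: "?T x = (\<chi> i. s i * x$i)" for x
    by (simp only: vec_eq_iff add_0 sum_Basis_vec_nth) (simp add: c inner_axis)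
  have "lborel = density (distr lborel borel ?T) (\<lambda>_. (\<Prod>b\<in>Basis. \<bar>c b\<bar>))"
    using s by (intro lborel_affine_euclidean) (auto simp: Basis_vec_real c less_imp_neq[symmetric])
  also have "(\<Prod>b\<in>Basis. \<bar>c b\<bar>) = (\<Prod>i\<in>UNIV. s i)"
    using s by (simp add: prod_Basis_vec c less_imp_le)
  finally have L: "lborel = density (distr lborel borel (\<lambda>x. \<chi> i. s i * x$i)) (\<lambda>_. ennreal (\<Prod>i\<in>UNIV. s i))"
    by (simp only: T)
  have [measurable]: "(\<lambda>x::real^'n. \<chi> i. s i * x$i) \<in> borel_measurable borel"
    by (intro borel_measurable_continuous_onI continuous_intros)
  have "(\<integral>\<^sup>+x. g x \<partial>lborel) =
      (\<integral>\<^sup>+x. g x \<partial>density (distr lborel borel (\<lambda>x. \<chi> i. s i * x$i)) (\<lambda>_. ennreal (\<Prod>i\<in>UNIV. s i)))"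
    by (rule arg_cong[OF L])
  also have "\<dots> = ennreal (\<Prod>i\<in>UNIV. s i) * (\<integral>\<^sup>+x. g (\<chi> i. s i * x$i) \<partial>lborel)"
    by (simp add: nn_integral_density nn_integral_distr nn_integral_cmult)
  finally show ?thesis .
qed

text \<open>With \<open>S = U diag(d) U\<^sup>T\<close> take \<open>L = U diag(sqrt d)\<close>: the substitution is a translation, an
  orthogonal map and a coordinatewise scaling, and only the last changes the volume.\<close>

lemma gaussian_substitution:
  fixes S :: "real^'n^'n"
  assumes S: "posdef S"
  obtains L :: "real^'n^'n" where "L ** transpose L = S" "invertible L"
    "\<forall>g\<in>borel_measurable borel. \<forall>m.
       (\<integral>\<^sup>+x. g x \<partial>lborel) = ennreal (sqrt (det S)) * (\<integral>\<^sup>+z. g (m + L *v z) \<partial>lborel)"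
proof -
  obtain U d where U: "orthogonal_matrix U" "\<forall>i. d i > 0" "S = spectral U d"
    by (rule posdef_spectral[OF S])
  define D :: "real^'n^'n" where "D = (\<chi> i j. if i = j then sqrt (d i) else 0)"
  have Dz: "D *v z = (\<chi> i. sqrt (d i) * z$i)" for z
  proof -
    have "(if i = j then sqrt (d i) else 0) * z$j = (if j = i then sqrt (d i) * z$i else 0)" for i j
      by simp
    then show ?thesis
      by (simp add: D_def vec_eq_iff matrix_vector_mult_def)
  qed
  define L where "L = U ** D"
  have "D ** transpose D = (\<chi> i j. if i = j then d i else 0)"
  proof -
    have "(if i = k then sqrt (d i) else 0) * (if j = k then sqrt (d j) else 0)
        = (if k = i then (if i = j then d i else 0) else 0)" for i j k
      using U(2) by (simp add: less_imp_le)
    then show ?thesis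
      by (simp add: D_def vec_eq_iff matrix_matrix_mult_def transpose_def)
  qed
  moreover have "L ** transpose L = U ** (D ** transpose D) ** transpose U"
    by (simp add: L_def matrix_transpose_mul matrix_mul_assoc)
  ultimately have LL: "L ** transpose L = S"
    by (simp add: U(3) spectral_eq_conjugated_diagonal)
  have "L ** (transpose L ** matrix_inv S) = mat 1"
    by (simp add: matrix_mul_assoc LL posdef_inv[OF S])
  then have inv: "invertible L"
    by (metis invertible_right_inverse)
  have "(\<Prod>i\<in>UNIV. sqrt (d i)) = sqrt (det S)"
    using U(2) by (intro real_sqrt_unique[symmetric] prod_nonneg)
      (simp_all add: U(3) det_spectral[OF U(1)] less_imp_le prod_power_distrib)
  then have "(\<integral>\<^sup>+x. g x \<partial>lborel) = ennreal (sqrt (det S)) * (\<integral>\<^sup>+z. g (m + L *v z) \<partial>lborel)"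
    if [measurable]: "g \<in> borel_measurable borel" for g m
    using nn_integral_lborel_translate[of g m] nn_integral_lborel_orthogonal[OF U(1), of "\<lambda>x. g (m + x)"]
      nn_integral_lborel_diagonal[of "\<lambda>x. g (m + U *v x)" "\<lambda>i. sqrt (d i)"] U(2)
    by (simp add: L_def Dz flip: matrix_vector_mul_assoc)
  then show ?thesis
    by (intro that[OF LL inv] ballI allI)
qed

section \<open>Moments of Gaussian measures\<close>

text \<open>Fubini for product integrands, with coordinates in place of the abstract basis.\<close>

lemma has_bochner_integral_lborel_prod:
  fixes f :: "'n::finite \<Rightarrow> real \<Rightarrow> real"
  assumes f: "\<And>i. integrable lborel (f i)"
  shows "has_bochner_integral lborel (\<lambda>x::real^'n. \<Prod>i\<in>UNIV. f i (x$i)) (\<Prod>i\<in>UNIV. \<integral>t. f i t \<partial>lborel)"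
proof -
  interpret product_sigma_finite "\<lambda>_::real^'n. lborel :: real measure"
    by standard
  define F :: "real^'n \<Rightarrow> real \<Rightarrow> real" where "F b = f (inv (\<lambda>i. axis i 1) b)" for b
  have F: "F (axis i 1) = f i" for i
    by (simp add: F_def inv_f_f[OF inj_axis])
  have [measurable]: "f i \<in> borel_measurable borel" for i
    using borel_measurable_integrable[OF f] by simp
  have "has_bochner_integral (\<Pi>\<^sub>M b\<in>(Basis :: (real^'n) set). lborel) (\<lambda>x. \<Prod>b\<in>Basis. F b (x b))
      (\<Prod>b\<in>Basis. \<integral>t. F b t \<partial>lborel)"
    unfolding has_bochner_integral_iff
    by (intro conjI product_integrable_prod product_integral_prod) (auto simp: F_def f)
  then have "has_bochner_integral (\<Pi>\<^sub>M b\<in>(Basis :: (real^'n) set). lborel)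
      (\<lambda>x. \<Prod>i\<in>UNIV. f i ((\<Sum>b\<in>Basis. x b *\<^sub>R b) $ i)) (\<Prod>i\<in>UNIV. \<integral>t. f i t \<partial>lborel)"
    by (simp only: prod_Basis_vec F sum_Basis_vec_nth)
  then show ?thesis
    by (subst lborel_eq) (intro has_bochner_integral_distr; measurable)
qed

lemma gaussian_density_pos: "posdef S \<Longrightarrow> gaussian_density m S x > 0"
  by (simp add: gaussian_density_def det_posdef_pos)

lemma continuous_gaussian_density: "continuous_on UNIV (gaussian_density m (S::real^'n^'n))"
proof -
  have "continuous_on UNIV (\<lambda>x. matrix_inv S *v (x - m))"
    by (intro continuous_on_compose2[OF linear_continuous_on[OF matrix_vector_mul_bounded_linear, of UNIV]]
        continuous_intros) auto
  then have "continuous_on UNIV (\<lambda>x. exp (- ((x - m) \<bullet> (matrix_inv S *v (x - m))) / 2)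
      / sqrt ((2 * pi) ^ CARD('n) * det S))"
    unfolding divide_inverse
    by (intro continuous_on_mult continuous_on_exp continuous_on_minus continuous_on_inner
        continuous_on_diff continuous_on_id continuous_on_const)
  then show ?thesis
    by (simp add: gaussian_density_def[abs_def])
qed

lemma measurable_gaussian_density [measurable]: "gaussian_density m S \<in> borel_measurable borel"
  by (rule borel_measurable_continuous_onI[OF continuous_gaussian_density])

lemma sets_gaussian [simp, measurable_cong]: "sets (gaussian m S) = sets borel"
  by (simp add: gaussian_def)

lemma space_gaussian [simp]: "space (gaussian m S) = UNIV"
  by (simp add: gaussian_def)

lemma standard_gaussian_density:
  "gaussian_density 0 (mat 1) (z::real^'n) = (\<Prod>i\<in>UNIV. std_normal_density (z$i))"
proof -
  have "(\<Prod>i\<in>UNIV. std_normal_density (z$i))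
      = (1 / sqrt (2 * pi)) ^ CARD('n) * exp (\<Sum>i\<in>UNIV. - (z$i)\<^sup>2 / 2)"
    unfolding std_normal_density_def prod.distrib exp_sum[OF finite_class.finite_UNIV] prod_constant
    by (rule refl)
  also have "\<dots> = exp (\<Sum>i\<in>UNIV. - (z$i)\<^sup>2 / 2) / sqrt ((2 * pi) ^ CARD('n))"
    by (simp only: power_one_over real_sqrt_power) simp
  finally have "(\<Prod>i\<in>UNIV. std_normal_density (z$i))
      = exp (\<Sum>i\<in>UNIV. - (z$i)\<^sup>2 / 2) / sqrt ((2 * pi) ^ CARD('n))" .
  moreover have "(\<Sum>i\<in>UNIV. - (z$i)\<^sup>2 / 2) = - (z \<bullet> z) / 2"
    by (simp add: inner_vec_def power2_eq_square sum_negf flip: sum_divide_distrib)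
  ultimately show ?thesis
    by (simp add: gaussian_density_def matrix_inv_mat_1)
qed

lemma standard_gaussian_monomial:
  "has_bochner_integral (gaussian 0 (mat 1)) (\<lambda>z::real^'n. \<Prod>i\<in>UNIV. z$i ^ e i)
     (\<Prod>i\<in>UNIV. \<integral>t. std_normal_density t * t ^ e i \<partial>lborel)"
  unfolding gaussian_def
proof (rule has_bochner_integral_density)
  show "has_bochner_integral lborel
      (\<lambda>z::real^'n. gaussian_density 0 (mat 1) z *\<^sub>R (\<Prod>i\<in>UNIV. z$i ^ e i))
      (\<Prod>i\<in>UNIV. \<integral>t. std_normal_density t * t ^ e i \<partial>lborel)"
    using has_bochner_integral_lborel_prod[of "\<lambda>i t. std_normal_density t * t ^ e i"]
    by (simp add: standard_gaussian_density prod.distrib integrable_std_normal_moment)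
qed (auto simp: standard_gaussian_density intro!: prod_nonneg)

lemma standard_gaussian_moments:
  fixes i j :: "'n::finite"
  shows "has_bochner_integral (gaussian 0 (mat 1)) (\<lambda>z::real^'n. 1) (1::real)"
    and "has_bochner_integral (gaussian 0 (mat 1)) (\<lambda>z::real^'n. z$i) 0"
    and "has_bochner_integral (gaussian 0 (mat 1)) (\<lambda>z::real^'n. z$i * z$j) (if i = j then 1 else 0)"
proof -
  have m0: "(\<integral>t. std_normal_density t \<partial>lborel) = 1"
    using integral_std_normal_moment_even[of 0] by simp
  have m1: "(\<integral>t. std_normal_density t * t \<partial>lborel) = 0"
    using integral_std_normal_moment_odd[of 0] by simp
  have m2: "(\<integral>t. std_normal_density t * t\<^sup>2 \<partial>lborel) = 1"
    using integral_std_normal_moment_even[of 1] by simp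
  show "has_bochner_integral (gaussian 0 (mat 1)) (\<lambda>z::real^'n. 1) (1::real)"
    using standard_gaussian_monomial[of "\<lambda>_. 0"] by (simp add: m0)
  have one: "(\<Prod>k\<in>UNIV. z$k ^ (if k = l then n else 0)) = z$l ^ n" for z :: "real^'n" and n l
    by (simp add: if_distrib cong: if_cong)
  have zero: "(\<Prod>k\<in>UNIV. \<integral>t. std_normal_density t * t ^ (if k = i then 1 else 0) \<partial>lborel) = 0"
    by (rule prod_zero) (auto intro!: bexI[of _ i] simp: m1)
  show "has_bochner_integral (gaussian 0 (mat 1)) (\<lambda>z::real^'n. z$i) 0"
    using standard_gaussian_monomial[of "\<lambda>k. if k = i then 1 else 0"]
    by (simp only: one power_one_right zero)
  show "has_bochner_integral (gaussian 0 (mat 1)) (\<lambda>z::real^'n. z$i * z$j) (if i = j then 1 else 0)"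
  proof (cases "i = j")
    case True
    have unit: "(\<Prod>k\<in>UNIV. \<integral>t. std_normal_density t * t ^ (if k = i then 2 else 0) \<partial>lborel) = 1"
      by (rule prod.neutral) (auto simp: m0 m2)
    have "has_bochner_integral (gaussian 0 (mat 1)) (\<lambda>z::real^'n. z$i * z$i) 1"
      using standard_gaussian_monomial[of "\<lambda>k. if k = i then 2 else 0"]
      by (simp only: one unit) (simp only: power2_eq_square)
    then show ?thesis
      using True by simp
  next
    case False
    let ?e = "\<lambda>k. (if k = i then 1 else 0) + (if k = j then 1 else (0::nat))"
    have zero: "(\<Prod>k\<in>UNIV. \<integral>t. std_normal_density t * t ^ ?e k \<partial>lborel) = 0"
      using False by (intro prod_zero) (auto intro!: bexI[of _ i] simp: m1)
    show ?thesis
      using standard_gaussian_monomial[of ?e] False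
      by (simp only: zero if_False) (simp only: power_add prod.distrib one power_one_right)
  qed
qed

text \<open>Reduces all moments to those of the standard Gaussian.\<close>

lemma gaussian_affine_image:
  fixes S :: "real^'n^'n"
  assumes S: "posdef S"
  obtains L :: "real^'n^'n" where "L ** transpose L = S"
    "\<forall>m. gaussian m S = distr (gaussian 0 (mat 1)) borel (\<lambda>z. m + L *v z)"
proof -
  obtain L :: "real^'n^'n" where L: "L ** transpose L = S" "invertible L" and
    sub: "\<forall>g\<in>borel_measurable borel. \<forall>m.
       (\<integral>\<^sup>+x. g x \<partial>lborel) = ennreal (sqrt (det S)) * (\<integral>\<^sup>+z. g (m + L *v z) \<partial>lborel)"
    by (rule gaussian_substitution[OF S])
  have LQL: "transpose L ** matrix_inv S ** L = mat 1"
  proof -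
    have "L ** (transpose L ** matrix_inv S) = mat 1"
      by (simp add: matrix_mul_assoc L posdef_inv[OF S])
    then show ?thesis
      by (simp add: matrix_left_right_inverse)
  qed
  have q: "(L *v z) \<bullet> (matrix_inv S *v (L *v z)) = z \<bullet> z" for z
  proof -
    have "z \<bullet> ((transpose L ** matrix_inv S ** L) *v z) = z \<bullet> (transpose L *v (matrix_inv S *v (L *v z)))"
      by (simp add: matrix_vector_mul_assoc matrix_mul_assoc del: transpose_matrix_vector)
    also have "\<dots> = (L *v z) \<bullet> (matrix_inv S *v (L *v z))"
      by (simp only: inner_matrix_vector_transpose transpose_transpose)
    finally show ?thesis
      by (simp add: LQL)
  qed
  have pos: "det S > 0"
    by (rule det_posdef_pos[OF S])
  have dens: "sqrt (det S) * gaussian_density m S (m + L *v z) = gaussian_density 0 (mat 1) z" for m z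
    using pos by (simp add: gaussian_density_def q matrix_inv_mat_1 real_sqrt_mult)
  have "gaussian m S = distr (gaussian 0 (mat 1)) borel (\<lambda>z. m + L *v z)" for m
  proof (rule measure_eqI)
    fix A assume "A \<in> sets (gaussian m S)"
    then have [measurable]: "A \<in> sets borel" by simp
    have "(\<lambda>z. m + L *v z) \<in> borel \<rightarrow>\<^sub>M borel" by measurable
    from measurable_sets[OF this, of A] have [measurable]: "(\<lambda>z. m + L *v z) -` A \<in> sets borel"
      by simp
    have "emeasure (gaussian m S) A = (\<integral>\<^sup>+x. ennreal (gaussian_density m S x) * indicator A x \<partial>lborel)"
      by (simp add: gaussian_def emeasure_density)
    also have "\<dots> = ennreal (sqrt (det S)) *
        (\<integral>\<^sup>+z. ennreal (gaussian_density m S (m + L *v z)) * indicator A (m + L *v z) \<partial>lborel)"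
      by (rule sub[rule_format]) measurable
    also have "\<dots> = (\<integral>\<^sup>+z. ennreal (sqrt (det S)) *
        (ennreal (gaussian_density m S (m + L *v z)) * indicator A (m + L *v z)) \<partial>lborel)"
      by (rule nn_integral_cmult[symmetric]) measurable
    also have "\<dots> = (\<integral>\<^sup>+z. ennreal (gaussian_density 0 (mat 1) z) * indicator ((\<lambda>z. m + L *v z) -` A) z \<partial>lborel)"
      using pos by (simp add: dens ennreal_mult'[symmetric] mult.assoc[symmetric] indicator_vimage)
    also have "\<dots> = emeasure (gaussian 0 (mat 1)) ((\<lambda>z. m + L *v z) -` A)"
      unfolding gaussian_def by (subst emeasure_density) simp_all
    also have "\<dots> = emeasure (distr (gaussian 0 (mat 1)) borel (\<lambda>z. m + L *v z)) A"
      by (subst emeasure_distr) simp_all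
    finally show "emeasure (gaussian m S) A = emeasure (distr (gaussian 0 (mat 1)) borel (\<lambda>z. m + L *v z)) A" .
  qed simp
  then show ?thesis
    by (intro that[OF L(1)] allI)
qed

lemma standard_gaussian_quadratic:
  "has_bochner_integral (gaussian 0 (mat 1)) (\<lambda>z::real^'n. z \<bullet> (M *v z) + u \<bullet> z + c) (trace M + c)"
proof -
  have "has_bochner_integral (gaussian 0 (mat 1)) (\<lambda>z::real^'n.
      (\<Sum>i\<in>UNIV. \<Sum>j\<in>UNIV. M$i$j * (z$i * z$j)) + (\<Sum>i\<in>UNIV. u$i * z$i) + c * 1)
      ((\<Sum>i\<in>UNIV. \<Sum>j\<in>UNIV. M$i$j * (if i = j then 1 else 0)) + (\<Sum>i\<in>(UNIV::'n set). u$i * 0) + c * 1)"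
    by (intro has_bochner_integral_add has_bochner_integral_sum has_bochner_integral_mult_right
        standard_gaussian_moments)
  moreover have "(\<Sum>i\<in>UNIV. \<Sum>j\<in>UNIV. M$i$j * (z$i * z$j)) + (\<Sum>i\<in>UNIV. u$i * z$i) + c * 1
      = z \<bullet> (M *v z) + u \<bullet> z + c" for z
    by (simp add: inner_vec_def matrix_vector_mult_def sum_distrib_left mult_ac)
  ultimately show ?thesis
    by (simp add: trace_def if_distrib cong: if_cong)
qed

lemma gaussian_quadratic:
  fixes S :: "real^'n^'n"
  assumes S: "posdef S"
  shows "has_bochner_integral (gaussian m S)
    (\<lambda>x. (x - m) \<bullet> (M *v (x - m)) + u \<bullet> (x - m) + c) (trace (M ** S) + c)"
proof -
  obtain L :: "real^'n^'n" where L: "L ** transpose L = S"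
    and G: "\<forall>m. gaussian m S = distr (gaussian 0 (mat 1)) borel (\<lambda>z. m + L *v z)"
    by (rule gaussian_affine_image[OF S])
  have "has_bochner_integral (gaussian 0 (mat 1)) (\<lambda>z. z \<bullet> ((transpose L ** M ** L) *v z)
      + (transpose L *v u) \<bullet> z + c) (trace (transpose L ** M ** L) + c)"
    by (rule standard_gaussian_quadratic)
  moreover have "trace (transpose L ** M ** L) = trace (M ** S)"
    by (subst matrix_mul_assoc[symmetric], subst trace_mul_sym) (simp add: L flip: matrix_mul_assoc)
  moreover have "z \<bullet> ((transpose L ** M ** L) *v z) = (L *v z) \<bullet> (M *v (L *v z))" for z
  proof -
    have "z \<bullet> ((transpose L ** M ** L) *v z) = z \<bullet> (transpose L *v (M *v (L *v z)))"
      by (simp add: matrix_vector_mul_assoc matrix_mul_assoc del: transpose_matrix_vector)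
    then show ?thesis
      by (simp only: inner_matrix_vector_transpose transpose_transpose)
  qed
  moreover have "(transpose L *v u) \<bullet> z = u \<bullet> (L *v z)" for z
    by (rule inner_matrix_vector_transpose[symmetric])
  ultimately have "has_bochner_integral (gaussian 0 (mat 1))
      (\<lambda>z. (L *v z) \<bullet> (M *v (L *v z)) + u \<bullet> (L *v z) + c) (trace (M ** S) + c)"
    by (simp del: transpose_matrix_vector)
  then show ?thesis
    unfolding G[rule_format, of m] by (intro has_bochner_integral_distr) (simp_all add: gaussian_def)
qed

section \<open>The Gaussian chart and the transport of scores\<close>

lemma quadratic_polynomial_unique:
  fixes M M' :: "real^'n^'n"
  assumes sym: "symmetric M" "symmetric M'"
    and eq: "\<And>x. x \<bullet> (M *v x) + u \<bullet> x + c = x \<bullet> (M' *v x) + u' \<bullet> x + c'"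
  shows "M = M'" "u = u'" "c = c'"
proof -
  show c: "c = c'"
    using eq[of 0] by simp
  have q: "x \<bullet> (M *v x) = x \<bullet> (M' *v x)" for x
    using eq[of x] eq[of "- x"] c by (simp add: linear_neg[OF matrix_vector_mul_linear])
  show "M = M'"
    using sym q by (rule symmetric_quadratic_form_unique)
  show "u = u'"
    using eq q c by (intro vector_eq_ldot[THEN iffD1]) (simp add: inner_commute)
qed

lemma AE_lborel_continuous_eq:
  fixes f g :: "'a::euclidean_space \<Rightarrow> real"
  assumes cont: "continuous_on UNIV f" "continuous_on UNIV g" and ae: "AE x in lborel. f x = g x"
  shows "f x = g x"
proof (rule ccontr)
  assume "f x \<noteq> g x"
  let ?N = "{x. f x \<noteq> g x}"
  have "open ?N"
    by (rule open_Collect_neq[OF cont])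
  moreover have "?N \<in> null_sets lborel"
    using ae \<open>open ?N\<close> by (subst AE_iff_null_sets) auto
  then have "negligible ?N"
    by (simp add: negligible_iff_null_sets null_sets_completionI)
  ultimately show False
    using open_not_negligible \<open>f x \<noteq> g x\<close> by blast
qed

lemma AE_gaussian_iff_AE_lborel:
  assumes "posdef S"
  shows "(AE x in gaussian m S. P x) \<longleftrightarrow> (AE x in lborel. P x)"
  unfolding gaussian_def using assms by (subst AE_density) (auto simp: gaussian_density_pos)

lemma continuous_on_quadratic [continuous_intros]:
  "continuous_on UNIV (\<lambda>x::real^'n. x \<bullet> (M *v x) + u \<bullet> x + c)"
  by (intro continuous_on_add continuous_on_inner continuous_on_id continuous_on_const
      linear_continuous_on matrix_vector_mul_bounded_linear)

lemma quadratic_expand: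
  fixes M :: "real^'n^'n"
  assumes "symmetric M"
  shows "(x - m) \<bullet> (M *v (x - m)) + u \<bullet> (x - m) + c
    = x \<bullet> (M *v x) + (u - 2 *\<^sub>R (M *v m)) \<bullet> x + (m \<bullet> (M *v m) - u \<bullet> m + c)"
  using symmetric_inner[OF assms, of x m] inner_commute[of m "M *v x"]
    inner_commute[of "M *v m" x]
  by (simp add: matrix_vector_mult_diff_distrib inner_diff_left inner_diff_right)

text \<open>Equal measures have densities that agree almost everywhere, hence everywhere by continuity.
  Comparing the quadratic and linear coefficients of their logarithms gives equality of
  \<open>\<Sigma>\<^sup>-\<^sup>1\<close> and then of \<open>\<Sigma>\<^sup>-\<^sup>1 m\<close>.\<close>

lemma gaussian_inj:
  fixes S S' :: "real^'n^'n"
  assumes S: "posdef S" and S': "posdef S'" and eq: "gaussian m S = gaussian m' S'"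
  shows "m = m'" "S = S'"
proof -
  define Q where "Q = matrix_inv S"
  define Q' where "Q' = matrix_inv S'"
  have sym: "symmetric Q" "symmetric Q'"
    using S S' by (auto simp: Q_def Q'_def intro!: posdef_symmetric posdef_matrix_inv)
  have "AE x in lborel. ennreal (gaussian_density m S x) = ennreal (gaussian_density m' S' x)"
    using eq unfolding gaussian_def by (subst sigma_finite_measure.density_unique_iff[OF sigma_finite_lborel, symmetric]) simp_all
  then have "AE x in lborel. gaussian_density m S x = gaussian_density m' S' x"
    using gaussian_density_pos[OF S] gaussian_density_pos[OF S'] by (auto simp: less_imp_le)
  then have dens: "gaussian_density m S x = gaussian_density m' S' x" for x
    by (rule AE_lborel_continuous_eq[OF continuous_gaussian_density continuous_gaussian_density])
  define k where "k S = ln (sqrt ((2 * pi) ^ CARD('n) * det S))" for S :: "real^'n^'n"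
  have ln_dens: "- 2 * ln (gaussian_density m S x)
      = (x - m) \<bullet> (matrix_inv S *v (x - m)) + 2 * k S" if "posdef S" for m x and S :: "real^'n^'n"
    using det_posdef_pos[OF that] by (simp add: gaussian_density_def ln_div k_def)
  have "(x - m) \<bullet> (Q *v (x - m)) + 0 \<bullet> (x - m) + 2 * k S
      = (x - m') \<bullet> (Q' *v (x - m')) + 0 \<bullet> (x - m') + 2 * k S'" for x
    using ln_dens[OF S, of m x] ln_dens[OF S', of m' x] dens[of x] by (simp add: Q_def Q'_def)
  note quad = quadratic_polynomial_unique[OF sym this[unfolded quadratic_expand[OF sym(1)] quadratic_expand[OF sym(2)]]]
  show "S = S'"
    using quad(1) S S' by (metis Q_def Q'_def matrix_inv_matrix_inv)
  have "Q *v m = Q *v m'"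
    using quad(1,2) by simp
  then show "m = m'"
    using posdef_inv_vec_left[OF S] by (metis Q_def)
qed

lemma gauss_chart_gaussian:
  assumes "posdef S"
  shows "gauss_chart (gaussian m S) = (m, S)"
proof -
  have "inj_on (\<lambda>(m, S). gaussian m S) (UNIV \<times> {S::real^'n^'n. posdef S})"
    by (rule inj_onI) (auto dest: gaussian_inj)
  from inv_into_f_f[OF this, of "(m, S)"] show ?thesis
    using assms by (simp add: gauss_chart_def)
qed

lemma gaussian_in_gaussians: "posdef S \<Longrightarrow> gaussian m S \<in> gaussians"
  by (auto simp: gaussians_def)

text \<open>The Hessian of the score of a tangent vector and the gradient of the score at the origin. They
  are the velocities of \<open>- \<Sigma>\<^sup>-\<^sup>1\<close> and \<open>\<Sigma>\<^sup>-\<^sup>1 m\<close>. Together they determine the score up to a constant, and that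
  constant is fixed by the zero-mean condition.\<close>

definition score_quadratic :: "real^'n^'n \<Rightarrow> real^'n^'n \<Rightarrow> real^'n^'n" where
  "score_quadratic S V = matrix_inv S ** V ** matrix_inv S"

definition score_linear :: "real^'n \<Rightarrow> real^'n^'n \<Rightarrow> 'n::finite tangent \<Rightarrow> real^'n" where
  "score_linear m S w = matrix_inv S *v fst w - score_quadratic S (snd w) *v m"

lemma symmetric_score_quadratic:
  "posdef S \<Longrightarrow> symmetric V \<Longrightarrow> symmetric (score_quadratic S V)"
  by (simp add: score_quadratic_def symmetric_sandwich posdef_symmetric posdef_matrix_inv)

lemma tangent_density_centered:
  assumes S: "posdef S"
  shows "tangent_density (gaussian m S) (v, V) x =
    (x - m) \<bullet> (((1/2) *\<^sub>R score_quadratic S V) *v (x - m)) + (matrix_inv S *v v) \<bullet> (x - m)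
      + (- trace (matrix_inv S ** V) / 2)"
  using S symmetric_inner[OF posdef_symmetric[OF posdef_matrix_inv[OF S]], of v "x - m"]
  by (simp add: tangent_density_def gauss_chart_gaussian Let_def score_quadratic_def
      flip: scaleR_matrix_vector_assoc)

lemma tangent_density_polynomial:
  assumes S: "posdef S" and V: "symmetric V"
  obtains c where "\<forall>x. tangent_density (gaussian m S) (v, V) x =
    x \<bullet> (((1/2) *\<^sub>R score_quadratic S V) *v x) + score_linear m S (v, V) \<bullet> x + c"
  using that unfolding tangent_density_centered[OF S]
    quadratic_expand[OF symmetric_scaleR[OF symmetric_score_quadratic[OF S V]]]
  by (simp add: score_linear_def flip: scaleR_matrix_vector_assoc)

lemma continuous_tangent_density:
  assumes S: "posdef S" and V: "symmetric V"
  shows "continuous_on UNIV (tangent_density (gaussian m S) (v, V))"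
proof -
  obtain c where "\<forall>x. tangent_density (gaussian m S) (v, V) x =
    x \<bullet> (((1/2) *\<^sub>R score_quadratic S V) *v x) + score_linear m S (v, V) \<bullet> x + c"
    by (rule tangent_density_polynomial[OF S V])
  then have "tangent_density (gaussian m S) (v, V) =
    (\<lambda>x. x \<bullet> (((1/2) *\<^sub>R score_quadratic S V) *v x) + score_linear m S (v, V) \<bullet> x + c)"
    by blast
  then show ?thesis
    by (simp only: continuous_on_quadratic)
qed

text \<open>The expectation of the quadratic part is half the trace of \<open>\<Sigma>\<^sup>-\<^sup>1 \<Sigma>\<^sub>v \<Sigma>\<^sup>-\<^sup>1 \<Sigma>\<close>, which the constant
  term cancels.\<close>

lemma tangent_density_mean_zero:
  assumes S: "posdef S"
  shows "has_bochner_integral (gaussian m S) (tangent_density (gaussian m S) (v, V)) 0"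
proof -
  have tr: "trace (((1/2) *\<^sub>R score_quadratic S V) ** S) = trace (matrix_inv S ** V) / 2"
  proof -
    have "((1/2) *\<^sub>R score_quadratic S V) ** S = (1/2) *\<^sub>R (matrix_inv S ** V)"
      by (simp add: score_quadratic_def posdef_inv[OF S]
          bounded_bilinear.scaleR_left[OF bounded_bilinear_matrix_matrix_mult] flip: matrix_mul_assoc)
    then show ?thesis
      by (simp add: trace_def sum_divide_distrib)
  qed
  have "has_bochner_integral (gaussian m S) (\<lambda>x. tangent_density (gaussian m S) (v, V) x) 0"
    unfolding tangent_density_centered[OF S]
    using gaussian_quadratic[OF S, of m "(1/2) *\<^sub>R score_quadratic S V" "matrix_inv S *v v"
        "- trace (matrix_inv S ** V) / 2"] unfolding tr by simp
  then show ?thesis .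
qed

lemma signed_density_eq_imp_AE:
  assumes "integrable \<mu> g" "integrable \<mu> h" "signed_density \<mu> g = signed_density \<mu> h"
  shows "AE x in \<mu>. g x = h x"
proof (rule density_unique_real[OF assms(1,2)])
  fix B assume "B \<in> sets \<mu>"
  then show "set_lebesgue_integral \<mu> B g = set_lebesgue_integral \<mu> B h"
    using fun_cong[OF assms(3), of B] by (simp add: signed_density_def)
qed

text \<open>This is what allows a transported signed measure to be read back as a coordinate velocity.\<close>

lemma tangent_measure_inj_on:
  fixes S :: "real^'n^'n"
  assumes S: "posdef S"
  shows "inj_on (tangent_measure (gaussian m S)) tangent_space"
proof (rule inj_onI)
  fix w w' :: "'n tangent"
  assume w: "w \<in> tangent_space" "w' \<in> tangent_space"
    and eq: "tangent_measure (gaussian m S) w = tangent_measure (gaussian m S) w'"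
  obtain v V v' V' where w_eq: "w = (v, V)" "w' = (v', V')" by (metis surj_pair)
  have V: "symmetric V" "symmetric V'"
    using w by (auto simp: tangent_space_def w_eq)
  let ?g = "tangent_density (gaussian m S)"
  have "AE x in gaussian m S. ?g (v, V) x = ?g (v', V') x"
    using eq tangent_density_mean_zero[OF S] unfolding tangent_measure_def w_eq
    by (intro signed_density_eq_imp_AE) (auto simp: has_bochner_integral_iff)
  then have "?g (v, V) x = ?g (v', V') x" for x
    unfolding AE_gaussian_iff_AE_lborel[OF S]
    by (rule AE_lborel_continuous_eq[OF continuous_tangent_density[OF S V(1)] continuous_tangent_density[OF S V(2)]])
  moreover obtain c where "\<forall>x. ?g (v, V) x =
      x \<bullet> (((1/2) *\<^sub>R score_quadratic S V) *v x) + score_linear m S (v, V) \<bullet> x + c"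
    by (rule tangent_density_polynomial[OF S V(1)])
  moreover obtain c' where "\<forall>x. ?g (v', V') x =
      x \<bullet> (((1/2) *\<^sub>R score_quadratic S V') *v x) + score_linear m S (v', V') \<bullet> x + c'"
    by (rule tangent_density_polynomial[OF S V(2)])
  ultimately have "x \<bullet> (((1/2) *\<^sub>R score_quadratic S V) *v x) + score_linear m S (v, V) \<bullet> x + c =
      x \<bullet> (((1/2) *\<^sub>R score_quadratic S V') *v x) + score_linear m S (v', V') \<bullet> x + c'" for x
    by simp
  note quad = quadratic_polynomial_unique[OF symmetric_scaleR[OF symmetric_score_quadratic[OF S V(1)]]
      symmetric_scaleR[OF symmetric_score_quadratic[OF S V(2)]] this]
  have recover: "X = S ** score_quadratic S X ** S" for X
    by (simp add: score_quadratic_def posdef_inv[OF S] posdef_inv_mult_left[OF S] flip: matrix_mul_assoc)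
  have C: "score_quadratic S V = score_quadratic S V'"
    using quad(1) by simp
  then have "V = V'"
    using recover[of V] recover[of V'] by simp
  moreover have "matrix_inv S *v v = matrix_inv S *v v'"
    using quad(2) C by (simp add: score_linear_def)
  then have "v = v'"
    using posdef_inv_vec_left[OF S] by metis
  ultimately show "w = w'"
    by (simp add: w_eq)
qed

text \<open>Parallel transport changes the score by a constant only, and every quadratic polynomial with
  mean zero is the score of a tangent vector. Hence transport preserves the quadratic and linear
  coefficients of the score. The chosen Radon-Nikodym derivative agrees with the score only almost
  everywhere, which suffices because all Gaussian measures have the same null sets.\<close>

lemma e0_transport_eqI:
  fixes S S' :: "real^'n^'n"
  assumes S: "posdef S" "posdef S'" and V: "symmetric V" "symmetric V'"
    and quad: "score_quadratic S' V' = score_quadratic S V"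
    and lin: "score_linear m' S' (v', V') = score_linear m S (v, V)"
  shows "e0_transport (gaussian m S) (gaussian m' S') (v, V) = (v', V')"
proof -
  let ?\<mu> = "gaussian m S" and ?\<nu> = "gaussian m' S'"
  let ?g = "tangent_density ?\<mu> (v, V)" and ?g' = "tangent_density ?\<nu> (v', V')"
  obtain c where c: "\<forall>x. ?g x = x \<bullet> (((1/2) *\<^sub>R score_quadratic S V) *v x) + score_linear m S (v, V) \<bullet> x + c"
    by (rule tangent_density_polynomial[OF S(1) V(1)])
  obtain c' where c': "\<forall>x. ?g' x =
      x \<bullet> (((1/2) *\<^sub>R score_quadratic S' V') *v x) + score_linear m' S' (v', V') \<bullet> x + c'"
    by (rule tangent_density_polynomial[OF S(2) V(2)])
  have gg': "?g x = ?g' x + (c - c')" for x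
    by (simp add: c c' quad lin)
  have int_g: "integrable ?\<mu> ?g"
    using tangent_density_mean_zero[OF S(1)] by (auto simp: has_bochner_integral_iff)
  define h where "h = signed_RN_deriv ?\<mu> (tangent_measure ?\<mu> (v, V))"
  have "integrable ?\<mu> h \<and> signed_density ?\<mu> h = tangent_measure ?\<mu> (v, V)"
    unfolding h_def signed_RN_deriv_def
    by (rule someI[of _ ?g]) (simp add: int_g tangent_measure_def)
  then have h: "integrable ?\<mu> h" "signed_density ?\<mu> h = signed_density ?\<mu> ?g"
    by (simp_all add: tangent_measure_def)
  have [measurable]: "h \<in> borel_measurable borel" "?g \<in> borel_measurable borel" "?g' \<in> borel_measurable borel"
    using borel_measurable_integrable[OF h(1)]
    by (auto intro!: borel_measurable_continuous_onI continuous_tangent_density S V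
        simp: measurable_cong_sets[OF sets_gaussian refl])
  have "AE x in ?\<mu>. h x = ?g x"
    by (rule signed_density_eq_imp_AE[OF h(1) int_g h(2)])
  then have ae: "AE x in ?\<nu>. h x = ?g' x + (c - c')"
    by (simp add: AE_gaussian_iff_AE_lborel S gg')
  have "has_bochner_integral ?\<nu> (\<lambda>x. ?g' x + (c - c')) (0 + (c - c'))"
    using gaussian_quadratic[OF S(2), of m' 0 0 "c - c'"]
    by (intro has_bochner_integral_add tangent_density_mean_zero[OF S(2)]) (simp add: trace_def)
  moreover have "(\<integral>x. h x \<partial>?\<nu>) = (\<integral>x. ?g' x + (c - c') \<partial>?\<nu>)"
    by (rule integral_cong_AE[OF _ _ ae]) measurable
  ultimately have mean: "(\<integral>x. h x \<partial>?\<nu>) = c - c'"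
    by (simp add: has_bochner_integral_iff)
  have "e0_transport_measure ?\<mu> ?\<nu> (tangent_measure ?\<mu> (v, V)) = signed_density ?\<nu> (\<lambda>x. h x - (c - c'))"
    by (simp add: e0_transport_measure_def h_def[symmetric] mean Let_def)
  also have "\<dots> = tangent_measure ?\<nu> (v', V')"
  proof -
    have "set_lebesgue_integral ?\<nu> B (\<lambda>x. h x - (c - c')) = set_lebesgue_integral ?\<nu> B ?g'"
      if "B \<in> sets ?\<nu>" for B
      by (rule set_lebesgue_integral_cong_AE) (use that ae in \<open>auto elim: eventually_mono\<close>)
    then show ?thesis
      by (auto simp: tangent_measure_def signed_density_def fun_eq_iff)
  qed
  finally show ?thesis
    using inv_into_f_f[OF tangent_measure_inj_on[OF S(2)], of "(v', V')" m'] V(2)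
    by (simp add: e0_transport_def tangent_space_def)
qed

text \<open>Solving the two conditions for the transported velocity.\<close>

lemma e0_transport_gaussian:
  fixes S S' :: "real^'n^'n"
  assumes S: "posdef S" "posdef S'" and V: "symmetric V"
  shows "e0_transport (gaussian m S) (gaussian m' S') (v, V)
    = (S' *v (score_linear m S (v, V) + score_quadratic S V *v m'), S' ** score_quadratic S V ** S')"
proof (rule e0_transport_eqI[OF S V])
  show "symmetric (S' ** score_quadratic S V ** S')"
    using S V by (intro symmetric_sandwich symmetric_score_quadratic) (auto intro: posdef_symmetric)
  show "score_quadratic S' (S' ** score_quadratic S V ** S') = score_quadratic S V"
    by (simp add: score_quadratic_def[of S'] posdef_inv[OF S(2)] posdef_inv_mult_right[OF S(2)] flip: matrix_mul_assoc)
  then show "score_linear m' S' (S' *v (score_linear m S (v, V) + score_quadratic S V *v m'),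
      S' ** score_quadratic S V ** S') = score_linear m S (v, V)"
    by (simp add: score_linear_def[of m'] posdef_inv_vec_right[OF S(2)])
qed

section \<open>Geodesics in coordinates\<close>

lemma at_within_interval_nontrivial:
  fixes T :: "real set"
  assumes "is_interval T" "0 \<in> T" "T \<noteq> {0}" "t \<in> T"
  shows "at t within T \<noteq> bot"
proof -
  have "T \<noteq> {x}" for x
    using assms(2,3) by auto
  then have "t islimpt T"
    using assms by (intro connected_imp_perfect is_interval_connected)
  then show ?thesis
    by (simp add: trivial_limit_within)
qed

text \<open>Velocities of Gaussian curves are tangent vectors: symmetry passes to the derivative because
  transposition is linear and derivatives within \<open>T\<close> are unique.\<close>

lemma has_vector_derivative_symmetric:
  fixes S :: "real \<Rightarrow> real^'n^'n"
  assumes S: "(S has_vector_derivative S') (at t within T)" and t: "at t within T \<noteq> bot" "t \<in> T"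
    and symm: "\<And>s. s \<in> T \<Longrightarrow> symmetric (S s)"
  shows "symmetric S'"
proof -
  have "((\<lambda>s. transpose (S s)) has_vector_derivative transpose S') (at t within T)"
    by (rule bounded_linear.has_vector_derivative[OF bounded_linear_transpose S])
  then have "(S has_vector_derivative transpose S') (at t within T)"
    by (rule has_vector_derivative_transform[OF t(2), rotated]) (use symm in \<open>simp add: symmetric_def\<close>)
  then have "S' = transpose S'"
    by (rule vector_derivative_unique_within[OF t(1) S])
  then show ?thesis
    unfolding symmetric_def by (rule sym)
qed

text \<open>The chart turns the geodesic condition into a differential equation for \<open>(m, \<Sigma>)\<close>; the converse is
  \<open>geodesicI_coordinates\<close>.\<close>

lemma geodesic_coordinates:
  fixes \<gamma> :: "real \<Rightarrow> (real^'n) measure"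
  assumes geo: "geodesic tr T \<gamma>"
  obtains m S m' S' where
    "\<forall>t\<in>T. \<gamma> t = gaussian (m t) (S t) \<and> posdef (S t)"
    "\<forall>t\<in>T. (m has_vector_derivative m' t) (at t within T)"
    "\<forall>t\<in>T. (S has_vector_derivative S' t) (at t within T)"
    "\<forall>t\<in>T. symmetric (S' t)"
    "\<forall>t\<in>T. velocity T \<gamma> t = (m' t, S' t)"
    "\<forall>t\<in>T. (m' t, S' t) = tr (\<gamma> 0) (\<gamma> t) (m' 0, S' 0)"
proof -
  define m where "m = fst \<circ> gauss_chart \<circ> \<gamma>"
  define S where "S = snd \<circ> gauss_chart \<circ> \<gamma>"
  define m' where "m' = fst \<circ> velocity T \<gamma>"
  define S' where "S' = snd \<circ> velocity T \<gamma>"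
  have T: "is_interval T" "0 \<in> T" "T \<noteq> {0}"
    using geo by (auto simp: geodesic_def)
  have vel: "((gauss_chart \<circ> \<gamma>) has_vector_derivative velocity T \<gamma> t) (at t within T)" if "t \<in> T" for t
  proof -
    have "(gauss_chart \<circ> \<gamma>) differentiable (at t within T)"
      using geo that by (simp add: geodesic_def)
    then show ?thesis
      unfolding velocity_def by (rule vector_derivative_works[THEN iffD1])
  qed
  have 1: "\<forall>t\<in>T. \<gamma> t = gaussian (m t) (S t) \<and> posdef (S t)"
  proof
    fix t assume "t \<in> T"
    then have "\<gamma> t \<in> gaussians"
      using geo by (simp add: geodesic_def)
    then obtain n V where "\<gamma> t = gaussian n V" "posdef V"
      by (auto simp: gaussians_def)
    then show "\<gamma> t = gaussian (m t) (S t) \<and> posdef (S t)"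
      by (simp add: m_def S_def gauss_chart_gaussian)
  qed
  have 2: "\<forall>t\<in>T. (m has_vector_derivative m' t) (at t within T)"
    using bounded_linear.has_vector_derivative[OF bounded_linear_fst vel]
    by (simp add: m_def m'_def o_def)
  have 3: "\<forall>t\<in>T. (S has_vector_derivative S' t) (at t within T)"
    using bounded_linear.has_vector_derivative[OF bounded_linear_snd vel]
    by (simp add: S_def S'_def o_def)
  have 4: "\<forall>t\<in>T. symmetric (S' t)"
  proof
    fix t assume t: "t \<in> T"
    show "symmetric (S' t)"
      by (rule has_vector_derivative_symmetric[OF _ at_within_interval_nontrivial[OF T t] t])
        (use 1 3 t posdef_symmetric in auto)
  qed
  have 5: "\<forall>t\<in>T. velocity T \<gamma> t = (m' t, S' t)"
    by (simp add: m'_def S'_def)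
  have 6: "\<forall>t\<in>T. (m' t, S' t) = tr (\<gamma> 0) (\<gamma> t) (m' 0, S' 0)"
    using geo unfolding geodesic_def m'_def S'_def o_def prod.collapse by blast
  show ?thesis
    by (rule that[OF 1 2 3 4 5 6])
qed

lemma geodesicI_coordinates:
  fixes \<gamma> :: "real \<Rightarrow> (real^'n) measure"
  assumes T: "is_interval T" "0 \<in> T" "T \<noteq> {0}"
    and \<gamma>: "\<And>t. t \<in> T \<Longrightarrow> \<gamma> t = gaussian (m t) (S t)" "\<And>t. t \<in> T \<Longrightarrow> posdef (S t)"
    and m': "\<And>t. t \<in> T \<Longrightarrow> (m has_vector_derivative m' t) (at t within T)"
    and S': "\<And>t. t \<in> T \<Longrightarrow> (S has_vector_derivative S' t) (at t within T)"
    and tr: "\<And>t. t \<in> T \<Longrightarrow> tr (\<gamma> 0) (\<gamma> t) (m' 0, S' 0) = (m' t, S' t)"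
  shows "geodesic tr T \<gamma>" "\<And>t. t \<in> T \<Longrightarrow> velocity T \<gamma> t = (m' t, S' t)"
proof -
  have der: "((gauss_chart \<circ> \<gamma>) has_vector_derivative (m' t, S' t)) (at t within T)" if t: "t \<in> T" for t
  proof -
    have "((\<lambda>t. (m t, S t)) has_vector_derivative (m' t, S' t)) (at t within T)"
      by (intro has_vector_derivative_Pair m'[OF t] S'[OF t])
    then show ?thesis
      by (rule has_vector_derivative_transform[OF t, rotated])
        (simp add: \<gamma> gauss_chart_gaussian)
  qed
  show vel: "\<And>t. t \<in> T \<Longrightarrow> velocity T \<gamma> t = (m' t, S' t)"
    unfolding velocity_def
    by (rule vector_derivative_within[OF at_within_interval_nontrivial[OF T] der])
  show "geodesic tr T \<gamma>"
    unfolding geodesic_def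
  proof (intro conjI ballI T)
    fix t assume t: "t \<in> T"
    show "\<gamma> t \<in> gaussians"
      using t by (simp add: \<gamma> gaussian_in_gaussians)
    show "(gauss_chart \<circ> \<gamma>) differentiable (at t within T)"
      by (rule differentiableI_vector[OF der[OF t]])
    show "velocity T \<gamma> t = tr (\<gamma> 0) (\<gamma> t) (velocity T \<gamma> 0)"
      by (simp only: vel[OF t] vel[OF T(2)] tr[OF t])
  qed
qed

lemma has_vector_derivative_zero_constant_on_interval:
  fixes f :: "real \<Rightarrow> 'a::real_normed_vector"
  assumes "is_interval T" "\<And>t. t \<in> T \<Longrightarrow> (f has_vector_derivative 0) (at t within T)" "s \<in> T" "t \<in> T"
  shows "f s = f t"
proof -
  have "\<exists>c. \<forall>x\<in>T. f x = c"
    by (rule has_derivative_zero_constant)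
      (use assms in \<open>auto simp: is_interval_convex has_vector_derivative_def\<close>)
  then show ?thesis
    using assms by auto
qed

section \<open>The e1-connection\<close>

lemma diagonal_entry_congruence:
  "(transpose M ** (S ** M)) $ i $ i = column i M \<bullet> (S *v column i (M::real^'n^'n))"
  by (simp add: matrix_matrix_mult_def transpose_def column_def inner_vec_def matrix_vector_mult_def)

text \<open>Pairing \<open>M S + S M\<close> with \<open>M\<close> in the trace form gives a sum of nonnegative terms, among them
  the values of the positive form \<open>S\<close> on all columns of \<open>M\<close>.\<close>

lemma lyapunov_kernel:
  fixes M S :: "real^'n^'n"
  assumes S: "posdef S" and zero: "M ** S + S ** M = 0"
  shows "M = 0"
proof -
  have nonneg: "trace (transpose N ** (S ** N)) \<ge> 0" for N :: "real^'n^'n"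
    using posdef_imp_possemidef[OF S]
    by (auto simp: trace_def diagonal_entry_congruence possemidef_def intro!: sum_nonneg)
  have "trace (transpose M ** (M ** S)) = trace (transpose (transpose M) ** (S ** transpose M))"
    by (metis matrix_mul_assoc trace_mul_sym transpose_transpose)
  moreover have "trace (transpose M ** (M ** S)) + trace (transpose M ** (S ** M)) = 0"
    using arg_cong[OF zero, of "\<lambda>X. trace (transpose M ** X)"]
    by (simp add: matrix_add_ldistrib trace_add) (simp add: trace_def matrix_matrix_mult_def)
  ultimately have "trace (transpose M ** (S ** M)) = 0"
    using nonneg[of M] nonneg[of "transpose M"] by linarith
  then have "(\<Sum>i\<in>UNIV. column i M \<bullet> (S *v column i M)) = 0"
    by (simp add: trace_def diagonal_entry_congruence)
  then have "column i M \<bullet> (S *v column i M) = 0" for i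
    using posdef_imp_possemidef[OF S] by (subst (asm) sum_nonneg_eq_0_iff) (auto simp: possemidef_def)
  then have "column i M = 0" for i
    using S by (metis less_irrefl posdef_def)
  then show ?thesis
    by (simp add: column_def vec_eq_iff)
qed

lemma lyapunov_unique:
  fixes A B S :: "real^'n^'n"
  assumes "posdef S" "A ** S + S ** A = B ** S + S ** B"
  shows "A = B"
proof -
  interpret bounded_bilinear "\<lambda>(A::real^'n^'n) (B::real^'n^'n). A ** B"
    by (rule bounded_bilinear_matrix_matrix_mult)
  have "(A - B) ** S + S ** (A - B) = 0"
    using assms(2) by (simp add: diff_left diff_right algebra_simps)
  then have "A - B = 0"
    by (rule lyapunov_kernel[OF assms(1)])
  then show ?thesis
    by simp
qed

text \<open>By \<open>lyapunov_unique\<close> the map \<open>A \<mapsto> A S + S A\<close> is an injective endomorphism of the space of all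
  matrices, hence surjective; the transpose of a solution for symmetric \<open>V\<close> is again a solution, so
  uniqueness makes it symmetric.\<close>

lemma lyapunov_solution:
  fixes S V :: "real^'n^'n"
  assumes S: "posdef S" and V: "symmetric V"
  obtains A where "symmetric A" "A ** S + S ** A = V"
proof -
  interpret bounded_bilinear "\<lambda>(A::real^'n^'n) (B::real^'n^'n). A ** B"
    by (rule bounded_bilinear_matrix_matrix_mult)
  let ?f = "\<lambda>A. A ** S + S ** A"
  have lin: "linear ?f"
    by (simp add: linear_iff add_left add_right scaleR_left scaleR_right algebra_simps)
  have "inj ?f"
    by (rule injI) (rule lyapunov_unique[OF S])
  then have "surj ?f"
    using lin by (simp add: linear_injective_imp_surjective)
  from surjD[OF this, of V] obtain A where A: "A ** S + S ** A = V"
    by auto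
  have "transpose A ** S + S ** transpose A = transpose (A ** S + S ** A)"
    using posdef_symmetric[OF S] by (simp add: symmetric_def transpose_add matrix_transpose_mul add.commute)
  also have "\<dots> = A ** S + S ** A"
    using A V by (simp add: symmetric_def)
  finally have "symmetric A"
    unfolding symmetric_def by (rule lyapunov_unique[OF S])
  then show ?thesis
    using A by (rule that)
qed

lemma e1_generator_eqI:
  fixes S :: "real^'n^'n"
  assumes S: "posdef S" and A: "symmetric A" "A ** S + S ** A = V" "A *v m + b = v"
  shows "e1_generator (gaussian m S) (v, V) = (A, b)"
proof -
  have "(THE p. case p of (A, b) \<Rightarrow> symmetric A \<and> A ** S + S ** A = V \<and> A *v m + b = v) = (A, b)"
  proof (rule the_equality)
    fix p assume p: "case p of (A', b') \<Rightarrow> symmetric A' \<and> A' ** S + S ** A' = V \<and> A' *v m + b' = v"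
    obtain A' b' where p_eq: "p = (A', b')" by (cases p)
    then have "A' = A"
      using p A lyapunov_unique[OF S, of A' A] by simp
    then show "p = (A, b)"
      using p p_eq A(3) by auto
  qed (use A in simp)
  then show ?thesis
    using S by (simp add: e1_generator_def gauss_chart_gaussian)
qed

lemma e1_transport_gaussian:
  fixes S S' :: "real^'n^'n"
  assumes "posdef S" "posdef S'" "symmetric A"
  shows "e1_transport (gaussian m S) (gaussian m' S') (A *v m + b, A ** S + S ** A)
    = (A *v m' + b, A ** S' + S' ** A)"
  using assms by (simp add: e1_transport_def gauss_chart_gaussian e1_generator_eqI)

lemma e1_geodesicI:
  fixes S0 A :: "real^'n^'n"
  assumes T: "is_interval T" "0 \<in> T" "T \<noteq> {0}"
    and A: "symmetric A" and S0: "posdef S0" and K: "exp_antiderivative A K"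
    and \<gamma>: "\<And>t. t \<in> T \<Longrightarrow> \<gamma> t = gaussian (matrix_exp (t *\<^sub>R A) *v m0 + K t *v b)
        (matrix_exp (t *\<^sub>R A) ** S0 ** matrix_exp (t *\<^sub>R A))"
  shows "geodesic e1_transport T \<gamma>" "velocity T \<gamma> 0 = (A *v m0 + b, A ** S0 + S0 ** A)"
proof -
  let ?E = "\<lambda>t. matrix_exp (t *\<^sub>R A)"
  let ?m = "\<lambda>t. ?E t *v m0 + K t *v b" and ?S = "\<lambda>t. ?E t ** S0 ** ?E t"
  let ?m' = "\<lambda>t. A *v ?m t + b" and ?S' = "\<lambda>t. A ** ?S t + ?S t ** A"
  have E: "(?E has_vector_derivative A ** ?E t) (at t within T)" for t
    by (rule has_vector_derivative_matrix_exp[OF A])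
  have pd: "posdef (?S t)" for t
    using posdef_matrix_exp[OF symmetric_scaleR[OF A], of t] S0
    by (intro posdef_sandwich) (auto intro: posdef_symmetric posdef_invertible)
  have m': "(?m has_vector_derivative ?m' t) (at t within T)" for t
  proof -
    have "(?m has_vector_derivative (?E t *v 0 + (A ** ?E t) *v m0) + (K t *v 0 + ?E t *v b)) (at t within T)"
      using K unfolding exp_antiderivative_def
      by (intro has_vector_derivative_add has_vector_derivative_matrix_vector_mult E
          has_vector_derivative_const) blast
    moreover have "A *v (K t *v b) = ?E t *v b - b"
      using K unfolding exp_antiderivative_def
      by (simp add: matrix_vector_mul_assoc matrix_vector_mult_diff_rdistrib)
    ultimately show ?thesis
      by (simp add: matrix_vector_right_distrib flip: matrix_vector_mul_assoc)
  qed
  have S': "(?S has_vector_derivative ?S' t) (at t within T)" for t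
  proof -
    have "(?S has_vector_derivative (?E t ** S0) ** (A ** ?E t) + (?E t ** 0 + (A ** ?E t) ** S0) ** ?E t) (at t within T)"
      by (intro has_vector_derivative_matrix_mult E has_vector_derivative_const)
    moreover have "(?E t ** S0) ** (A ** ?E t) + (?E t ** 0 + (A ** ?E t) ** S0) ** ?E t = ?S' t"
      using matrix_exp_commute[OF A, of t]
      by (simp add: bounded_bilinear.zero_right[OF bounded_bilinear_matrix_matrix_mult] add.commute
          flip: matrix_mul_assoc)
    ultimately show ?thesis by simp
  qed
  have z: "?m 0 = m0" "?S 0 = S0"
    using K by (simp_all add: exp_antiderivative_def matrix_exp_zero)
  have tr: "e1_transport (\<gamma> 0) (\<gamma> t) (?m' 0, ?S' 0) = (?m' t, ?S' t)" if "t \<in> T" for t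
    unfolding \<gamma>[OF that] \<gamma>[OF T(2)]
    by (rule e1_transport_gaussian[OF pd pd A])
  note g = geodesicI_coordinates[where T = T and \<gamma> = \<gamma> and tr = e1_transport and m = ?m and S = ?S and m' = ?m' and S' = ?S', OF T \<gamma> pd m' S' tr]
  show "geodesic e1_transport T \<gamma>"
    by (rule g(1))
  have "velocity T \<gamma> 0 = (?m' 0, ?S' 0)"
    by (rule g(2)[OF _ _ T(2)])
  then show "velocity T \<gamma> 0 = (A *v m0 + b, A ** S0 + S0 ** A)"
    by (simp only: z)
qed

text \<open>The generator \<open>(A, b)\<close> is constant along an e1-geodesic, so the coordinates solve the linear
  system \<open>m' = A m + b\<close>, \<open>\<Sigma>' = A \<Sigma> + \<Sigma> A\<close>. Conjugating with \<open>e\<^sup>-\<^sup>t\<^sup>A\<close> turns its solutions into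
  constants.\<close>

lemma e1_geodesic_explicit:
  fixes \<gamma> :: "real \<Rightarrow> (real^'n) measure"
  assumes geo: "geodesic e1_transport T \<gamma>"
  obtains m0 S0 A b where "posdef S0" "symmetric A" "\<gamma> 0 = gaussian m0 S0"
    "\<forall>t\<in>T. e1_generator (\<gamma> t) (velocity T \<gamma> t) = (A, b)"
    "\<forall>K. exp_antiderivative A K \<longrightarrow> (\<forall>t\<in>T. \<gamma> t = gaussian (matrix_exp (t *\<^sub>R A) *v m0 + K t *v b)
        (matrix_exp (t *\<^sub>R A) ** S0 ** matrix_exp (t *\<^sub>R A)))"
proof -
  interpret mm: bounded_bilinear "\<lambda>(A::real^'n^'n) (B::real^'n^'n). A ** B"
    by (rule bounded_bilinear_matrix_matrix_mult)
  obtain m S m' S' where \<gamma>: "\<forall>t\<in>T. \<gamma> t = gaussian (m t) (S t) \<and> posdef (S t)"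
    and m': "\<forall>t\<in>T. (m has_vector_derivative m' t) (at t within T)"
    and S': "\<forall>t\<in>T. (S has_vector_derivative S' t) (at t within T)"
    and sym: "\<forall>t\<in>T. symmetric (S' t)"
    and vel: "\<forall>t\<in>T. velocity T \<gamma> t = (m' t, S' t)"
    and tr: "\<forall>t\<in>T. (m' t, S' t) = e1_transport (\<gamma> 0) (\<gamma> t) (m' 0, S' 0)"
    by (rule geodesic_coordinates[OF geo])
  have T: "is_interval T" "0 \<in> T"
    using geo by (auto simp: geodesic_def)
  have pd0: "posdef (S 0)"
    using \<gamma> T by blast
  obtain A where A: "symmetric A" "A ** S 0 + S 0 ** A = S' 0"
    using sym T(2) by (auto intro: lyapunov_solution[OF pd0])
  define b where "b = m' 0 - A *v m 0"
  have ode: "m' t = A *v m t + b" "S' t = A ** S t + S t ** A" if "t \<in> T" for t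
  proof -
    have w0: "(m' 0, S' 0) = (A *v m 0 + b, A ** S 0 + S 0 ** A)"
      by (simp add: A b_def)
    have \<gamma>0: "\<gamma> 0 = gaussian (m 0) (S 0)" and \<gamma>t: "\<gamma> t = gaussian (m t) (S t)" "posdef (S t)"
      using \<gamma> T that by blast+
    have "(m' t, S' t) = e1_transport (\<gamma> 0) (\<gamma> t) (m' 0, S' 0)"
      using tr that by blast
    also have "\<dots> = (A *v m t + b, A ** S t + S t ** A)"
      unfolding w0 \<gamma>0 \<gamma>t(1) by (rule e1_transport_gaussian[OF pd0 \<gamma>t(2) A(1)])
    finally show "m' t = A *v m t + b" "S' t = A ** S t + S t ** A"
      by simp_all
  qed
  have gen: "\<forall>t\<in>T. e1_generator (\<gamma> t) (velocity T \<gamma> t) = (A, b)"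
  proof
    fix t assume t: "t \<in> T"
    have "e1_generator (gaussian (m t) (S t)) (m' t, S' t) = (A, b)"
      using \<gamma> t ode[OF t] A(1) by (intro e1_generator_eqI) auto
    then show "e1_generator (\<gamma> t) (velocity T \<gamma> t) = (A, b)"
      using \<gamma> vel t by simp
  qed
  let ?E = "\<lambda>t. matrix_exp (t *\<^sub>R A)"
  \<comment> \<open>The inverse flow, by which solutions are conjugated.\<close>
  define F where "F t = matrix_exp (t *\<^sub>R (- A))" for t
  have nA: "symmetric (- A)"
    by (rule symmetric_uminus[OF A(1)])
  have F: "(F has_vector_derivative - (F t ** A)) (at t within T)" for t
    using has_vector_derivative_matrix_exp[OF nA, of t T] matrix_exp_commute[OF nA, of t]
    unfolding F_def[abs_def] by (simp add: mm.minus_right mm.minus_left)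
  have FA: "F t ** A = A ** F t" for t
    using matrix_exp_commute[OF nA, of t] unfolding F_def by (simp add: mm.minus_right mm.minus_left)
  have FE: "F t ** ?E t = mat 1" for t
    using matrix_exp_neg[OF A(1), of t] by (simp add: F_def)
  then have EF: "?E t ** F t = mat 1" for t
    by (simp add: matrix_left_right_inverse)
  have E0: "?E 0 = mat 1" "F 0 = mat 1"
    by (simp_all add: F_def matrix_exp_zero)
  have S_eq: "S t = ?E t ** S 0 ** ?E t" if t: "t \<in> T" for t
  proof -
    have "((\<lambda>t. F t ** S t ** F t) has_vector_derivative 0) (at t within T)" if "t \<in> T" for t
    proof -
      have "((\<lambda>t. F t ** S t ** F t) has_vector_derivative
          (F t ** S t) ** (- (F t ** A)) + (F t ** S' t + (- (F t ** A)) ** S t) ** F t) (at t within T)"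
        using S' that by (intro has_vector_derivative_matrix_mult F) auto
      moreover have "(F t ** S t) ** (- (F t ** A)) + (F t ** S' t + (- (F t ** A)) ** S t) ** F t = 0"
        by (simp add: ode[OF that] FA[symmetric] mm.add_left mm.add_right mm.minus_left mm.minus_right
            flip: matrix_mul_assoc)
      ultimately show ?thesis by simp
    qed
    from has_vector_derivative_zero_constant_on_interval[OF T(1) this t T(2)]
    have "F t ** S t ** F t = S 0"
      by (simp add: E0)
    then have "?E t ** S 0 ** ?E t = ?E t ** (F t ** S t ** F t) ** ?E t"
      by simp
    also have "\<dots> = (?E t ** F t) ** S t ** (F t ** ?E t)"
      by (simp add: matrix_mul_assoc)
    finally show ?thesis
      by (simp add: EF FE)
  qed
  have m_eq: "m t = ?E t *v m 0 + K t *v b" if K: "exp_antiderivative A K" and t: "t \<in> T" for K t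
  proof -
    define x where "x s = m s - (?E s *v m 0 + K s *v b)" for s
    have x': "(x has_vector_derivative A *v x s) (at s within T)" if s: "s \<in> T" for s
    proof -
      have "(x has_vector_derivative m' s - ((?E s *v 0 + (A ** ?E s) *v m 0) + (K s *v 0 + ?E s *v b))) (at s within T)"
        unfolding x_def using K m' s unfolding exp_antiderivative_def
        by (intro has_vector_derivative_diff has_vector_derivative_add has_vector_derivative_matrix_vector_mult
            has_vector_derivative_matrix_exp A has_vector_derivative_const) blast+
      moreover have "?E s *v b = A *v (K s *v b) + b"
        using K unfolding exp_antiderivative_def
        by (simp add: matrix_vector_mul_assoc matrix_vector_mult_diff_rdistrib)
      ultimately show ?thesis
        by (simp add: x_def ode[OF s] matrix_vector_right_distrib matrix_vector_mult_diff_distrib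
            algebra_simps flip: matrix_vector_mul_assoc)
    qed
    have "((\<lambda>s. F s *v x s) has_vector_derivative 0) (at s within T)" if "s \<in> T" for s
    proof -
      have "((\<lambda>s. F s *v x s) has_vector_derivative F s *v (A *v x s) + (- (F s ** A)) *v x s) (at s within T)"
        by (intro has_vector_derivative_matrix_vector_mult F x'[OF that])
      moreover have "F s *v (A *v x s) + (- (F s ** A)) *v x s = 0"
        by (simp add: matrix_vector_mul_assoc bounded_bilinear.minus_left[OF bounded_bilinear_matrix_vector_mult])
      ultimately show ?thesis by simp
    qed
    from has_vector_derivative_zero_constant_on_interval[OF T(1) this t T(2)]
    have "F t *v x t = 0"
      using K by (simp add: x_def E0 matrix_exp_zero exp_antiderivative_def)
    then have "?E t *v (F t *v x t) = 0"
      by simp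
    then have "x t = 0"
      by (simp add: matrix_vector_mul_assoc EF)
    then show ?thesis
      by (simp add: x_def)
  qed
  show ?thesis
  proof (rule that[OF pd0 A(1) _ gen])
    show "\<gamma> 0 = gaussian (m 0) (S 0)"
      using \<gamma> T by blast
    show "\<forall>K. exp_antiderivative A K \<longrightarrow> (\<forall>t\<in>T. \<gamma> t = gaussian (?E t *v m 0 + K t *v b) (?E t ** S 0 ** ?E t))"
      using \<gamma> S_eq m_eq by metis
  qed
qed

lemma UNIV_neq_singleton: "UNIV \<noteq> {0::real}"
  by (metis UNIV_I singletonD zero_neq_one)

lemma e1_complete: "geodesically_complete (e1_transport :: 'n::finite parallel_transport)"
  unfolding geodesically_complete_def
proof (intro ballI)
  fix \<mu> :: "(real^'n) measure" and w :: "'n tangent"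
  assume "\<mu> \<in> gaussians" "w \<in> tangent_space"
  then obtain m S v V where \<mu>: "\<mu> = gaussian m S" "posdef S" and w: "w = (v, V)" "symmetric V"
    by (auto simp: gaussians_def tangent_space_def)
  obtain A where A: "symmetric A" "A ** S + S ** A = V"
    using lyapunov_solution[OF \<mu>(2) w(2)] .
  obtain K where K: "exp_antiderivative A K"
    by (rule exp_antiderivative_exists[OF A(1)])
  define \<gamma> where "\<gamma> t = gaussian (matrix_exp (t *\<^sub>R A) *v m + K t *v (v - A *v m))
        (matrix_exp (t *\<^sub>R A) ** S ** matrix_exp (t *\<^sub>R A))" for t
  note g = e1_geodesicI[of UNIV A S K \<gamma>, OF _ _ _ A(1) \<mu>(2) K \<gamma>_def]
  have "\<gamma> 0 = \<mu>"
    using K by (simp add: \<gamma>_def \<mu> matrix_exp_zero exp_antiderivative_def)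
  then show "\<exists>\<gamma>. geodesic e1_transport UNIV \<gamma> \<and> \<gamma> 0 = \<mu> \<and> velocity UNIV \<gamma> 0 = w"
    using g UNIV_neq_singleton by (intro exI[of _ \<gamma>]) (simp add: w A)
qed

lemma e1_extend: "geodesics_extend (e1_transport :: 'n::finite parallel_transport)"
  unfolding geodesics_extend_def
proof (intro allI impI)
  fix T and \<gamma> :: "real \<Rightarrow> (real^'n) measure"
  assume geo: "geodesic e1_transport T \<gamma>"
  obtain m0 S0 A b where *: "posdef S0" "symmetric A" "\<gamma> 0 = gaussian m0 S0"
    "\<forall>t\<in>T. e1_generator (\<gamma> t) (velocity T \<gamma> t) = (A, b)"
    "\<forall>K. exp_antiderivative A K \<longrightarrow> (\<forall>t\<in>T. \<gamma> t = gaussian (matrix_exp (t *\<^sub>R A) *v m0 + K t *v b)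
        (matrix_exp (t *\<^sub>R A) ** S0 ** matrix_exp (t *\<^sub>R A)))"
    by (rule e1_geodesic_explicit[OF geo])
  obtain K where K: "exp_antiderivative A K"
    by (rule exp_antiderivative_exists[OF *(2)])
  define \<gamma>' where "\<gamma>' t = gaussian (matrix_exp (t *\<^sub>R A) *v m0 + K t *v b)
        (matrix_exp (t *\<^sub>R A) ** S0 ** matrix_exp (t *\<^sub>R A))" for t
  have "geodesic e1_transport UNIV \<gamma>'"
    using e1_geodesicI(1)[of UNIV A S0 K \<gamma>', OF _ _ _ *(2,1) K \<gamma>'_def] UNIV_neq_singleton by simp
  then show "\<exists>\<gamma>'. geodesic e1_transport UNIV \<gamma>' \<and> (\<forall>t\<in>T. \<gamma>' t = \<gamma> t)"
    using * K by (intro exI[of _ \<gamma>']) (simp add: \<gamma>'_def)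
qed

section \<open>The e0-connection\<close>

text \<open>Lines in the natural parameters \<open>(\<Sigma>\<^sup>-\<^sup>1, \<Sigma>\<^sup>-\<^sup>1 m)\<close> are geodesics as long as the precision matrix stays
  positive definite: their velocity has the same score coefficients \<open>C\<close> and \<open>d\<close> at all times.\<close>

lemma e0_geodesicI:
  fixes S0 C :: "real^'n^'n"
  assumes T: "is_interval T" "0 \<in> T" "T \<noteq> {0}" and C: "symmetric C"
    and pd: "\<And>t. t \<in> T \<Longrightarrow> posdef (P0 - t *\<^sub>R C)"
    and \<gamma>: "\<And>t. t \<in> T \<Longrightarrow> \<gamma> t = gaussian
      (matrix_inv (P0 - t *\<^sub>R C) *v (\<eta>0 + t *\<^sub>R d)) (matrix_inv (P0 - t *\<^sub>R C))"
  shows "geodesic e0_transport T \<gamma>"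
proof -
  interpret mm: bounded_bilinear "\<lambda>(A::real^'n^'n) (B::real^'n^'n). A ** B"
    by (rule bounded_bilinear_matrix_matrix_mult)
  define S where "S t = matrix_inv (P0 - t *\<^sub>R C)" for t
  define m where "m t = S t *v (\<eta>0 + t *\<^sub>R d)" for t
  have S_pd: "posdef (S t)" if "t \<in> T" for t
    unfolding S_def by (rule posdef_matrix_inv[OF pd[OF that]])
  have invS: "matrix_inv (S t) = P0 - t *\<^sub>R C" if "t \<in> T" for t
    unfolding S_def by (rule matrix_inv_matrix_inv[OF pd[OF that]])
  have P': "((\<lambda>t. P0 - t *\<^sub>R C) has_vector_derivative - C) (at t within T)" for t
    by (auto intro!: derivative_eq_intros)
  have S': "(S has_vector_derivative S t ** C ** S t) (at t within T)" if "t \<in> T" for t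
  proof -
    have "((\<lambda>t. matrix_inv (P0 - t *\<^sub>R C)) has_vector_derivative
        - (matrix_inv (P0 - t *\<^sub>R C) ** (- C) ** matrix_inv (P0 - t *\<^sub>R C))) (at t within T)"
      by (rule has_vector_derivative_matrix_inv[OF P' posdef_invertible[OF pd] that])
    then show ?thesis
      by (simp add: S_def[abs_def] mm.minus_left mm.minus_right)
  qed
  have m': "(m has_vector_derivative S t *v (d + C *v m t)) (at t within T)" if "t \<in> T" for t
  proof -
    have "((\<lambda>t. \<eta>0 + t *\<^sub>R d) has_vector_derivative d) (at t within T)"
      by (auto intro!: derivative_eq_intros)
    from has_vector_derivative_matrix_vector_mult[OF S'[OF that] this]
    show ?thesis
      by (simp add: m_def[abs_def] matrix_vector_right_distrib flip: matrix_vector_mul_assoc)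
  qed
  have tr: "e0_transport (\<gamma> 0) (\<gamma> t) (S 0 *v (d + C *v m 0), S 0 ** C ** S 0)
      = (S t *v (d + C *v m t), S t ** C ** S t)" if t: "t \<in> T" for t
  proof -
    have q: "score_quadratic (S s) (S s ** C ** S s) = C" if "s \<in> T" for s
      using S_pd[OF that] by (simp add: score_quadratic_def posdef_inv_mult_right posdef_inv flip: matrix_mul_assoc)
    have sym: "symmetric (S s ** C ** S s)" if "s \<in> T" for s
      by (rule symmetric_sandwich[OF posdef_symmetric[OF S_pd[OF that]] C])
    have l: "score_linear (m s) (S s) (S s *v (d + C *v m s), S s ** C ** S s) = d" if "s \<in> T" for s
      by (simp add: score_linear_def q[OF that] posdef_inv_vec_right[OF S_pd[OF that]])
    have g: "\<gamma> s = gaussian (m s) (S s)" if "s \<in> T" for s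
      using \<gamma>[OF that] by (simp add: m_def S_def)
    show ?thesis
      unfolding g[OF t] g[OF T(2)]
      by (rule e0_transport_eqI) (simp_all add: S_pd t T q l sym)
  qed
  show ?thesis
    by (rule geodesicI_coordinates(1)[where m = m and S = S and m' = "\<lambda>t. S t *v (d + C *v m t)"
          and S' = "\<lambda>t. S t ** C ** S t", OF T])
      (use \<gamma> S_pd m' S' tr in \<open>simp_all add: m_def S_def\<close>)
qed

text \<open>Along an e0-geodesic the coefficients \<open>C\<close> and \<open>d\<close> of the score are constant. The coordinate
  velocity \<open>\<Sigma>' = \<Sigma> C \<Sigma>\<close>, \<open>m' = \<Sigma> (d + C m)\<close> then says that the precision matrix \<open>\<Sigma>\<^sup>-\<^sup>1\<close> has
  derivative \<open>- C\<close> and that \<open>\<Sigma>\<^sup>-\<^sup>1 m\<close> has derivative \<open>d\<close>.\<close>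

lemma e0_geodesic_explicit:
  fixes \<gamma> :: "real \<Rightarrow> (real^'n) measure"
  assumes geo: "geodesic e0_transport T \<gamma>"
  obtains m0 S0 C d where "posdef S0" "\<gamma> 0 = gaussian m0 S0"
    "velocity T \<gamma> 0 = (S0 *v (d + C *v m0), S0 ** C ** S0)"
    "\<forall>t\<in>T. posdef (matrix_inv S0 - t *\<^sub>R C) \<and> \<gamma> t = gaussian
      (matrix_inv (matrix_inv S0 - t *\<^sub>R C) *v (matrix_inv S0 *v m0 + t *\<^sub>R d))
      (matrix_inv (matrix_inv S0 - t *\<^sub>R C))"
proof -
  interpret mm: bounded_bilinear "\<lambda>(A::real^'n^'n) (B::real^'n^'n). A ** B"
    by (rule bounded_bilinear_matrix_matrix_mult)
  obtain m S m' S' where \<gamma>: "\<forall>t\<in>T. \<gamma> t = gaussian (m t) (S t) \<and> posdef (S t)"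
    and m': "\<forall>t\<in>T. (m has_vector_derivative m' t) (at t within T)"
    and S': "\<forall>t\<in>T. (S has_vector_derivative S' t) (at t within T)"
    and sym: "\<forall>t\<in>T. symmetric (S' t)"
    and vel: "\<forall>t\<in>T. velocity T \<gamma> t = (m' t, S' t)"
    and tr: "\<forall>t\<in>T. (m' t, S' t) = e0_transport (\<gamma> 0) (\<gamma> t) (m' 0, S' 0)"
    by (rule geodesic_coordinates[OF geo])
  have T: "is_interval T" "0 \<in> T"
    using geo by (auto simp: geodesic_def)
  have g: "\<gamma> t = gaussian (m t) (S t)" and pd: "posdef (S t)" if "t \<in> T" for t
    using \<gamma> that by blast+
  define C where "C = score_quadratic (S 0) (S' 0)"
  define d where "d = score_linear (m 0) (S 0) (m' 0, S' 0)"
  have ode: "m' t = S t *v (d + C *v m t)" "S' t = S t ** C ** S t" if t: "t \<in> T" for t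
  proof -
    have "(m' t, S' t) = e0_transport (\<gamma> 0) (\<gamma> t) (m' 0, S' 0)"
      using tr t by blast
    also have "\<dots> = (S t *v (d + C *v m t), S t ** C ** S t)"
      unfolding g[OF t] g[OF T(2)] C_def d_def
      by (rule e0_transport_gaussian[OF pd[OF T(2)] pd[OF t]]) (use sym T in blast)
    finally show "m' t = S t *v (d + C *v m t)" "S' t = S t ** C ** S t"
      by simp_all
  qed
  define P where "P t = matrix_inv (S t)" for t
  have P': "(P has_vector_derivative - C) (at t within T)" if t: "t \<in> T" for t
  proof -
    have "(P has_vector_derivative - (P t ** S' t ** P t)) (at t within T)"
      unfolding P_def[abs_def]
      by (rule has_vector_derivative_matrix_inv[OF _ posdef_invertible[OF pd] t]) (use S' t in blast)
    moreover have "P t ** S' t ** P t = C"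
      using pd[OF t] by (simp add: ode[OF t] P_def posdef_inv_mult_right posdef_inv flip: matrix_mul_assoc)
    ultimately show ?thesis by simp
  qed
  have P_eq: "P t = P 0 - t *\<^sub>R C" if t: "t \<in> T" for t
  proof -
    have "((\<lambda>t. P t + t *\<^sub>R C) has_vector_derivative 0) (at s within T)" if "s \<in> T" for s
      by (rule has_vector_derivative_eq_rhs[OF has_vector_derivative_add[OF P'[OF that]
            bounded_linear.has_vector_derivative[OF bounded_linear_scaleR_left has_vector_derivative_id]]]) simp
    from has_vector_derivative_zero_constant_on_interval[OF T(1) this t T(2)]
    show ?thesis
      by (simp add: algebra_simps)
  qed
  have \<eta>_eq: "P t *v m t = P 0 *v m 0 + t *\<^sub>R d" if t: "t \<in> T" for t
  proof -
    have "((\<lambda>t. P t *v m t - t *\<^sub>R d) has_vector_derivative 0) (at s within T)" if s: "s \<in> T" for s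
    proof -
      have "((\<lambda>t. P t *v m t) has_vector_derivative P s *v m' s + (- C) *v m s) (at s within T)"
        by (rule has_vector_derivative_matrix_vector_mult[OF P'[OF s]]) (use m' s in blast)
      moreover have "P s *v m' s + (- C) *v m s = d"
        using pd[OF s] by (simp add: ode[OF s] P_def posdef_inv_vec_right
            bounded_bilinear.minus_left[OF bounded_bilinear_matrix_vector_mult])
      ultimately have "((\<lambda>t. P t *v m t) has_vector_derivative d) (at s within T)"
        by simp
      then show ?thesis
        by (rule has_vector_derivative_eq_rhs[OF has_vector_derivative_diff[OF _
            bounded_linear.has_vector_derivative[OF bounded_linear_scaleR_left has_vector_derivative_id]]]) simp
    qed
    from has_vector_derivative_zero_constant_on_interval[OF T(1) this t T(2)]
    show ?thesis
      by (simp add: algebra_simps)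
  qed
  have main: "\<forall>t\<in>T. posdef (matrix_inv (S 0) - t *\<^sub>R C) \<and> \<gamma> t = gaussian
      (matrix_inv (matrix_inv (S 0) - t *\<^sub>R C) *v (matrix_inv (S 0) *v m 0 + t *\<^sub>R d))
      (matrix_inv (matrix_inv (S 0) - t *\<^sub>R C))"
  proof
    fix t assume t: "t \<in> T"
    have P: "matrix_inv (S 0) - t *\<^sub>R C = P t" "matrix_inv (S 0) *v m 0 + t *\<^sub>R d = P t *v m t"
      using P_eq[OF t] \<eta>_eq[OF t] by (simp_all add: P_def)
    have "matrix_inv (P t) = S t" "posdef (P t)"
      using pd[OF t] by (simp_all add: P_def matrix_inv_matrix_inv posdef_matrix_inv)
    moreover have "S t *v (P t *v m t) = m t"
      using pd[OF t] by (simp add: P_def posdef_inv_vec_left)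
    ultimately show "posdef (matrix_inv (S 0) - t *\<^sub>R C) \<and> \<gamma> t = gaussian
      (matrix_inv (matrix_inv (S 0) - t *\<^sub>R C) *v (matrix_inv (S 0) *v m 0 + t *\<^sub>R d))
      (matrix_inv (matrix_inv (S 0) - t *\<^sub>R C))"
      unfolding P by (simp add: g[OF t])
  qed
  have "velocity T \<gamma> 0 = (S 0 *v (d + C *v m 0), S 0 ** C ** S 0)"
    using vel ode[OF T(2)] T by simp
  then show ?thesis
    by (rule that[OF pd[OF T(2)] g[OF T(2)] _ main])
qed

lemma not_posdef_zero: "\<not> posdef (0 :: real^'n^'n)"
  unfolding posdef_def by (auto intro!: exI[of _ "axis undefined 1"] simp: axis_eq_0_iff)

lemma posdef_scaleR_mat_1: "c > 0 \<Longrightarrow> posdef (c *\<^sub>R mat 1 :: real^'n^'n)"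
  by (auto simp: posdef_def symmetric_def transpose_scalar inner_gt_zero_iff simp flip: scaleR_matrix_vector_assoc)

text \<open>From the standard Gaussian with initial velocity \<open>(0, I)\<close> the precision matrix is
  \<open>(1 - t) I\<close>, which degenerates at \<open>t = 1\<close>.\<close>

lemma e0_not_complete: "\<not> geodesically_complete (e0_transport :: 'n::finite parallel_transport)"
proof
  assume "geodesically_complete (e0_transport :: 'n parallel_transport)"
  moreover have I: "posdef (mat 1 :: real^'n^'n)"
    using posdef_scaleR_mat_1[of 1] by simp
  then have "gaussian 0 (mat 1 :: real^'n^'n) \<in> gaussians" "(0, mat 1) \<in> (tangent_space :: 'n tangent set)"
    by (auto simp: tangent_space_def gaussian_in_gaussians posdef_symmetric)
  ultimately obtain \<gamma> :: "real \<Rightarrow> (real^'n) measure" where geo: "geodesic e0_transport UNIV \<gamma>"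
    and init: "\<gamma> 0 = gaussian 0 (mat 1)" "velocity UNIV \<gamma> 0 = (0, mat 1)"
    unfolding geodesically_complete_def by blast
  obtain m0 :: "real^'n" and S0 C :: "real^'n^'n" and d :: "real^'n" where S0: "posdef S0" "\<gamma> 0 = gaussian m0 S0"
    "velocity UNIV \<gamma> 0 = (S0 *v (d + C *v m0), S0 ** C ** S0)"
    and all: "\<forall>t\<in>UNIV. posdef (matrix_inv S0 - t *\<^sub>R C) \<and> \<gamma> t = gaussian
      (matrix_inv (matrix_inv S0 - t *\<^sub>R C) *v (matrix_inv S0 *v m0 + t *\<^sub>R d))
      (matrix_inv (matrix_inv S0 - t *\<^sub>R C))"
    by (rule e0_geodesic_explicit[OF geo])
  have "S0 = mat 1"
    using gaussian_inj(2)[OF S0(1) I] S0(2) init(1) by metis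
  then have "matrix_inv S0 = mat 1" "C = mat 1"
    using init(2) S0(3) by (simp_all add: matrix_inv_mat_1)
  then have "posdef (mat 1 - 1 *\<^sub>R (mat 1 :: real^'n^'n))"
    using all by (metis UNIV_I)
  then show False
    by (simp add: not_posdef_zero)
qed

text \<open>The same ray restricted to \<open>{0..1/2}\<close> is a geodesic there. An extension would have an affine
  precision matrix, so it would agree with \<open>(1 - t) I\<close> for all \<open>t\<close>.\<close>

lemma e0_not_extend: "\<not> geodesics_extend (e0_transport :: 'n::finite parallel_transport)"
proof
  assume ext: "geodesics_extend (e0_transport :: 'n parallel_transport)"
  let ?T = "{0..1/2::real}"
  have pd: "posdef (mat 1 - t *\<^sub>R (mat 1 :: real^'n^'n))" if "t \<in> ?T" for t
  proof -
    have "mat 1 - t *\<^sub>R (mat 1 :: real^'n^'n) = (1 - t) *\<^sub>R mat 1"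
      by (simp add: scaleR_diff_left)
    then show ?thesis
      using that by (simp only:) (intro posdef_scaleR_mat_1, simp)
  qed
  define \<gamma> :: "real \<Rightarrow> (real^'n) measure" where "\<gamma> t = gaussian
      (matrix_inv (mat 1 - t *\<^sub>R mat 1) *v (0 + t *\<^sub>R 0)) (matrix_inv (mat 1 - t *\<^sub>R mat 1))" for t
  have "1/2 \<in> ?T" by simp
  then have "?T \<noteq> {0}" by (metis divide_eq_0_iff singletonD zero_neq_numeral zero_neq_one)
  then have "geodesic e0_transport ?T \<gamma>"
    by (intro e0_geodesicI[where C = "mat 1" and ?P0.0 = "mat 1" and ?\<eta>0.0 = 0 and d = 0])
      (auto simp: is_interval_cc symmetric_def \<gamma>_def pd)
  then obtain \<gamma>' where geo: "geodesic e0_transport UNIV \<gamma>'" and eq: "\<forall>t\<in>?T. \<gamma>' t = \<gamma> t"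
    using ext unfolding geodesics_extend_def by blast
  obtain m0 :: "real^'n" and S0 C :: "real^'n^'n" and d :: "real^'n" where S0: "posdef S0" "\<gamma>' 0 = gaussian m0 S0"
    "velocity UNIV \<gamma>' 0 = (S0 *v (d + C *v m0), S0 ** C ** S0)"
    and all: "\<forall>t\<in>UNIV. posdef (matrix_inv S0 - t *\<^sub>R C) \<and> \<gamma>' t = gaussian
      (matrix_inv (matrix_inv S0 - t *\<^sub>R C) *v (matrix_inv S0 *v m0 + t *\<^sub>R d))
      (matrix_inv (matrix_inv S0 - t *\<^sub>R C))"
    by (rule e0_geodesic_explicit[OF geo])
  have P: "matrix_inv S0 - t *\<^sub>R C = mat 1 - t *\<^sub>R mat 1" if t: "t \<in> ?T" for t
  proof -
    have pd': "posdef (matrix_inv S0 - t *\<^sub>R C)"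
      and g': "\<gamma>' t = gaussian (matrix_inv (matrix_inv S0 - t *\<^sub>R C) *v (matrix_inv S0 *v m0 + t *\<^sub>R d))
      (matrix_inv (matrix_inv S0 - t *\<^sub>R C))"
      using all by blast+
    have "matrix_inv (matrix_inv S0 - t *\<^sub>R C) = matrix_inv (mat 1 - t *\<^sub>R mat 1)"
      by (rule gaussian_inj(2)[OF posdef_matrix_inv[OF pd'] posdef_matrix_inv[OF pd[OF t]]
            trans[OF sym[OF g'] bspec[OF eq t, unfolded \<gamma>_def]]])
    from arg_cong[OF this, of matrix_inv] show ?thesis
      unfolding matrix_inv_matrix_inv[OF pd'] matrix_inv_matrix_inv[OF pd[OF t]] .
  qed
  have P0: "matrix_inv S0 = mat 1"
    using P[of 0] by simp
  have "(1/2) *\<^sub>R C = (1/2) *\<^sub>R (mat 1 :: real^'n^'n)"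
    using P[of "1/2"] by (simp add: P0)
  then have "C = mat 1"
    by simp
  moreover have "posdef (matrix_inv S0 - 1 *\<^sub>R C)"
    using all by blast
  ultimately show False
    by (simp add: P0 not_posdef_zero)
qed

section \<open>Geodesics between two given Gaussian measures\<close>

text \<open>Conjugating \<open>R \<Sigma>\<^sub>0 R = \<Sigma>\<^sub>1\<close> by the square root \<open>Q\<close> of \<open>\<Sigma>\<^sub>0\<close> turns it into the statement that
  \<open>Q R Q\<close> is the square root of \<open>Q \<Sigma>\<^sub>1 Q\<close>.\<close>

lemma posdef_transport_matrix:
  fixes S0 S1 :: "real^'n^'n"
  assumes S: "posdef S0" "posdef S1"
  defines "R \<equiv> matrix_inv (matrix_sqrt S0) ** matrix_sqrt (matrix_sqrt S0 ** S1 ** matrix_sqrt S0)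
             ** matrix_inv (matrix_sqrt S0)"
  shows "posdef R" "R ** S0 ** R = S1" "\<And>X. posdef X \<Longrightarrow> X ** S0 ** X = S1 \<Longrightarrow> X = R"
proof -
  define Q where "Q = matrix_sqrt S0"
  define J where "J = matrix_inv Q"
  define G where "G = matrix_sqrt (Q ** S1 ** Q)"
  have Q: "posdef Q" "Q ** Q = S0"
    unfolding Q_def by (rule posdef_matrix_sqrt[OF S(1)])+
  have J: "posdef J"
    unfolding J_def by (rule posdef_matrix_inv[OF Q(1)])
  have c: "Q ** (J ** X) = X" "J ** (Q ** X) = X" "J ** Q = mat 1" "Q ** J = mat 1" for X :: "real^'n^'n"
    unfolding J_def by (simp_all add: posdef_inv_mult_left posdef_inv_mult_right posdef_inv Q(1))
  have QSQ: "posdef (Q ** S1 ** Q)"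
    using Q S by (intro posdef_sandwich) (auto intro: posdef_symmetric posdef_invertible)
  have G: "posdef G" "G ** G = Q ** S1 ** Q"
    unfolding G_def by (rule posdef_matrix_sqrt[OF QSQ])+
  have R: "R = J ** G ** J"
    by (simp add: R_def J_def G_def Q_def)
  show "posdef R"
    unfolding R using J G by (intro posdef_sandwich) (auto intro: posdef_symmetric posdef_invertible)
  have "R ** S0 ** R = J ** (G ** G) ** J"
    unfolding R Q(2)[symmetric] by (simp add: c flip: matrix_mul_assoc)
  also have "\<dots> = S1"
    unfolding G(2) by (simp add: c flip: matrix_mul_assoc)
  finally show "R ** S0 ** R = S1" .
  show "X = R" if X: "posdef X" "X ** S0 ** X = S1" for X
  proof -
    have "posdef (Q ** X ** Q)"
      using Q X by (intro posdef_sandwich) (auto intro: posdef_symmetric posdef_invertible)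
    moreover have "(Q ** X ** Q) ** (Q ** X ** Q) = Q ** (X ** (Q ** Q) ** X) ** Q"
      by (simp add: matrix_mul_assoc)
    then have "(Q ** X ** Q) ** (Q ** X ** Q) = Q ** S1 ** Q"
      by (simp only: Q(2) X(2))
    ultimately have "G = Q ** X ** Q"
      unfolding G_def by (intro matrix_sqrt_eqI posdef_imp_possemidef)
    then show ?thesis
      by (simp add: R c flip: matrix_mul_assoc)
  qed
qed

lemma is_interval_unit: "is_interval {0..1::real}" "0 \<in> {0..1::real}" "{0..1} \<noteq> {0::real}"
proof -
  show "{0..1} \<noteq> {0::real}"
    by (metis atLeastAtMost_iff order_refl singletonD zero_le_one zero_neq_one)
qed (auto simp: is_interval_cc)

lemma e1_geodesic_between_exists:
  fixes m0 m1 :: "real^'n" and S0 S1 :: "real^'n^'n"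
  assumes S: "posdef S0" "posdef S1"
  defines "R \<equiv> matrix_inv (matrix_sqrt S0) ** matrix_sqrt (matrix_sqrt S0 ** S1 ** matrix_sqrt S0)
             ** matrix_inv (matrix_sqrt S0)"
  defines "A \<equiv> matrix_log R"
  defines "b \<equiv> matrix_inv (int_exp 1 A) *v (m1 - R *v m0)"
  defines "\<gamma> \<equiv> restrict (\<lambda>t. gaussian (matrix_rpow R t *v m0 + int_exp t A *v b)
                          (matrix_rpow R t ** S0 ** matrix_rpow R t)) {0..1}"
  shows "geodesic_between e1_transport (gaussian m0 S0) (gaussian m1 S1) \<gamma>"
proof -
  note R = posdef_transport_matrix[OF S, folded R_def]
  have A: "symmetric A" "matrix_exp A = R"
    unfolding A_def by (rule matrix_log_posdef[OF R(1)])+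
  obtain K where K: "exp_antiderivative A K" "\<forall>t\<ge>0. int_exp t A = K t" "invertible (K 1)"
    by (rule exp_antiderivative_exists[OF A(1)])
  have rpow: "matrix_rpow R t = matrix_exp (t *\<^sub>R A)" for t
    by (simp add: matrix_rpow_def A_def)
  have \<gamma>: "\<gamma> t = gaussian (matrix_exp (t *\<^sub>R A) *v m0 + K t *v b)
      (matrix_exp (t *\<^sub>R A) ** S0 ** matrix_exp (t *\<^sub>R A))" if "t \<in> {0..1}" for t
    using that K(2) by (simp add: \<gamma>_def rpow)
  have "geodesic e1_transport {0..1} \<gamma>"
    by (rule e1_geodesicI(1)[OF is_interval_unit A(1) S(1) K(1) \<gamma>])
  moreover have "\<gamma> 0 = gaussian m0 S0"
    using \<gamma>[of 0] K(1) by (simp add: matrix_exp_zero exp_antiderivative_def)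
  moreover have "K 1 *v b = m1 - R *v m0"
    using K(2,3) by (simp add: b_def matrix_vector_mul_assoc matrix_inv_inverse)
  then have "\<gamma> 1 = gaussian m1 S1"
    using \<gamma>[of 1] by (simp add: A(2) R(2))
  ultimately show ?thesis
    by (simp add: geodesic_between_def)
qed

text \<open>At \<open>t = 1\<close> the covariance equation says \<open>e\<^sup>A \<Sigma>\<^sub>0 e\<^sup>A = \<Sigma>\<^sub>1\<close>. Since \<open>e\<^sup>A\<close> is positive definite, it is the
  matrix \<open>R\<close>, and symmetric logarithms are unique; invertibility of the integral of the exponential
  then determines \<open>b\<close> from the means.\<close>

lemma e1_geodesic_between_explicit:
  fixes m0 m1 :: "real^'n" and S0 S1 :: "real^'n^'n"
  assumes S: "posdef S0" "posdef S1"
    and geo: "geodesic_between e1_transport (gaussian m0 S0) (gaussian m1 S1) \<gamma>" and t: "t \<in> {0..1}"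
  defines "R \<equiv> matrix_inv (matrix_sqrt S0) ** matrix_sqrt (matrix_sqrt S0 ** S1 ** matrix_sqrt S0)
             ** matrix_inv (matrix_sqrt S0)"
  defines "A \<equiv> matrix_log R"
  defines "b \<equiv> matrix_inv (int_exp 1 A) *v (m1 - R *v m0)"
  shows "\<gamma> t = gaussian (matrix_rpow R t *v m0 + int_exp t A *v b)
                          (matrix_rpow R t ** S0 ** matrix_rpow R t)"
    "e1_generator (\<gamma> t) (velocity {0..1} \<gamma> t) = (A, b)"
proof -
  note R = posdef_transport_matrix[OF S, folded R_def]
  have g: "geodesic e1_transport {0..1} \<gamma>" "\<gamma> 0 = gaussian m0 S0" "\<gamma> 1 = gaussian m1 S1"
    using geo by (auto simp: geodesic_between_def)
  obtain m0' :: "real^'n" and S0' A' :: "real^'n^'n" and b' :: "real^'n" where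
    *: "posdef S0'" "symmetric A'" "\<gamma> 0 = gaussian m0' S0'"
    "\<forall>t\<in>{0..1}. e1_generator (\<gamma> t) (velocity {0..1} \<gamma> t) = (A', b')"
    "\<forall>K. exp_antiderivative A' K \<longrightarrow> (\<forall>t\<in>{0..1}. \<gamma> t = gaussian (matrix_exp (t *\<^sub>R A') *v m0' + K t *v b')
        (matrix_exp (t *\<^sub>R A') ** S0' ** matrix_exp (t *\<^sub>R A')))"
    by (rule e1_geodesic_explicit[OF g(1)])
  have init: "m0' = m0" "S0' = S0"
    using gaussian_inj[OF *(1) S(1)] *(3) g(2) by metis+
  obtain K where K: "exp_antiderivative A' K" "\<forall>t\<ge>0. int_exp t A' = K t" "invertible (K 1)"
    by (rule exp_antiderivative_exists[OF *(2)])
  have \<gamma>: "\<gamma> t = gaussian (matrix_exp (t *\<^sub>R A') *v m0 + K t *v b')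
        (matrix_exp (t *\<^sub>R A') ** S0 ** matrix_exp (t *\<^sub>R A'))" if "t \<in> {0..1}" for t
    using *(5) K(1) that unfolding init by blast
  have E: "posdef (matrix_exp A')"
    by (rule posdef_matrix_exp[OF *(2)])
  have pd: "posdef (matrix_exp A' ** S0 ** matrix_exp A')"
    using E S by (intro posdef_sandwich) (auto intro: posdef_symmetric posdef_invertible)
  have "gaussian (matrix_exp A' *v m0 + K 1 *v b') (matrix_exp A' ** S0 ** matrix_exp A') = gaussian m1 S1"
    using \<gamma>[of 1] g(3) by simp
  note end_eq = gaussian_inj[OF pd S(2) this]
  have "matrix_exp A' = R"
    by (rule R(3)[OF E end_eq(2)])
  then have A: "A' = A"
    unfolding A_def by (rule matrix_log_eqI[OF *(2), symmetric])
  have "K 1 *v b' = m1 - R *v m0"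
    using end_eq(1) \<open>matrix_exp A' = R\<close> by (simp add: algebra_simps)
  then have "matrix_inv (K 1) *v (K 1 *v b') = b"
    using K(2) by (simp add: b_def A)
  then have b: "b' = b"
    using K(3) by (simp add: matrix_vector_mul_assoc matrix_inv_inverse)
  show "\<gamma> t = gaussian (matrix_rpow R t *v m0 + int_exp t A *v b)
                          (matrix_rpow R t ** S0 ** matrix_rpow R t)"
    using \<gamma>[OF t] K(2) t by (simp add: A b matrix_rpow_def A_def[symmetric])
  show "e1_generator (\<gamma> t) (velocity {0..1} \<gamma> t) = (A, b)"
    using *(4) t unfolding A b by blast
qed

text \<open>The segment of precision matrices stays in the positive definite cone because the cone is
  convex; this is why the e0-connection is geodesically connected although rays may leave the cone.\<close>

lemma e0_geodesic_between_exists: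
  fixes m0 m1 :: "real^'n" and S0 S1 :: "real^'n^'n"
  assumes S: "posdef S0" "posdef S1"
  defines "P \<equiv> \<lambda>t. (1 - t) *\<^sub>R matrix_inv S0 + t *\<^sub>R matrix_inv S1"
  defines "\<eta> \<equiv> \<lambda>t. (1 - t) *\<^sub>R (matrix_inv S0 *v m0) + t *\<^sub>R (matrix_inv S1 *v m1)"
  defines "\<gamma> \<equiv> restrict (\<lambda>t. gaussian (matrix_inv (P t) *v \<eta> t) (matrix_inv (P t))) {0..1}"
  shows "geodesic_between e0_transport (gaussian m0 S0) (gaussian m1 S1) \<gamma>"
proof -
  define C where "C = matrix_inv S0 - matrix_inv S1"
  define d where "d = matrix_inv S1 *v m1 - matrix_inv S0 *v m0"
  have P: "P t = matrix_inv S0 - t *\<^sub>R C" and \<eta>: "\<eta> t = matrix_inv S0 *v m0 + t *\<^sub>R d" for t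
    by (simp_all add: P_def \<eta>_def C_def d_def algebra_simps)
  have inv: "posdef (matrix_inv S0)" "posdef (matrix_inv S1)"
    using S by (auto intro: posdef_matrix_inv)
  have "symmetric C"
    using symmetric_add[OF posdef_symmetric[OF inv(1)] symmetric_uminus[OF posdef_symmetric[OF inv(2)]]]
    by (simp add: C_def)
  moreover have "posdef (matrix_inv S0 - t *\<^sub>R C)" if "t \<in> {0..1}" for t
    using posdef_convex_combination[OF inv that] P[of t] by (simp add: P_def)
  moreover have "\<gamma> t = gaussian (matrix_inv (matrix_inv S0 - t *\<^sub>R C) *v (matrix_inv S0 *v m0 + t *\<^sub>R d))
      (matrix_inv (matrix_inv S0 - t *\<^sub>R C))" if "t \<in> {0..1}" for t
    using that by (simp only: \<gamma>_def restrict_apply P \<eta> if_True)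
  ultimately have "geodesic e0_transport {0..1} \<gamma>"
    by (rule e0_geodesicI[OF is_interval_unit])
  moreover have "\<gamma> 0 = gaussian m0 S0" "\<gamma> 1 = gaussian m1 S1"
    using S by (simp_all add: \<gamma>_def P_def \<eta>_def matrix_inv_matrix_inv posdef_inv_vec_left)
  ultimately show ?thesis
    by (simp add: geodesic_between_def)
qed

lemma e0_geodesic_between_explicit:
  fixes m0 m1 :: "real^'n" and S0 S1 :: "real^'n^'n"
  assumes S: "posdef S0" "posdef S1"
    and geo: "geodesic_between e0_transport (gaussian m0 S0) (gaussian m1 S1) \<gamma>" and t: "t \<in> {0..1}"
  defines "P \<equiv> \<lambda>t. (1 - t) *\<^sub>R matrix_inv S0 + t *\<^sub>R matrix_inv S1"
  defines "\<eta> \<equiv> \<lambda>t. (1 - t) *\<^sub>R (matrix_inv S0 *v m0) + t *\<^sub>R (matrix_inv S1 *v m1)"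
  shows "\<gamma> t = gaussian (matrix_inv (P t) *v \<eta> t) (matrix_inv (P t))"
proof -
  have g: "geodesic e0_transport {0..1} \<gamma>" "\<gamma> 0 = gaussian m0 S0" "\<gamma> 1 = gaussian m1 S1"
    using geo by (auto simp: geodesic_between_def)
  obtain m0' :: "real^'n" and S0' C :: "real^'n^'n" and d :: "real^'n" where
    *: "posdef S0'" "\<gamma> 0 = gaussian m0' S0'" "velocity {0..1} \<gamma> 0 = (S0' *v (d + C *v m0'), S0' ** C ** S0')"
    "\<forall>t\<in>{0..1}. posdef (matrix_inv S0' - t *\<^sub>R C) \<and> \<gamma> t = gaussian
      (matrix_inv (matrix_inv S0' - t *\<^sub>R C) *v (matrix_inv S0' *v m0' + t *\<^sub>R d))
      (matrix_inv (matrix_inv S0' - t *\<^sub>R C))"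
    by (rule e0_geodesic_explicit[OF g(1)])
  have init: "m0' = m0" "S0' = S0"
    using gaussian_inj[OF *(1) S(1)] *(2) g(2) by metis+
  define P1 where "P1 = matrix_inv S0 - C"
  define \<eta>1 where "\<eta>1 = matrix_inv S0 *v m0 + d"
  have "posdef P1" "\<gamma> 1 = gaussian (matrix_inv P1 *v \<eta>1) (matrix_inv P1)"
    using *(4)[rule_format, of 1] by (simp_all add: init P1_def \<eta>1_def)
  then have m1: "matrix_inv P1 *v \<eta>1 = m1" and S1: "matrix_inv P1 = S1"
    using gaussian_inj[OF posdef_matrix_inv[OF \<open>posdef P1\<close>] S(2)] g(3) by metis+
  have P1: "P1 = matrix_inv S1"
    using matrix_inv_matrix_inv[OF \<open>posdef P1\<close>] by (simp add: S1)
  have "P1 *v m1 = \<eta>1"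
    unfolding m1[symmetric] by (rule posdef_inv_vec_left[OF \<open>posdef P1\<close>])
  then have \<eta>1: "\<eta>1 = matrix_inv S1 *v m1"
    by (simp add: P1)
  have C: "C = matrix_inv S0 - matrix_inv S1"
    using P1 by (simp add: P1_def algebra_simps)
  have d: "d = matrix_inv S1 *v m1 - matrix_inv S0 *v m0"
    using \<eta>1 by (simp add: \<eta>1_def algebra_simps)
  have "matrix_inv S0 - t *\<^sub>R C = P t" "matrix_inv S0 *v m0 + t *\<^sub>R d = \<eta> t"
    by (simp_all add: P_def \<eta>_def C d algebra_simps)
  then show ?thesis
    using *(4)[rule_format, OF t] by (simp add: init)
qed

text \<open>A curve on \<open>T\<close> is represented by the function that is \<open>undefined\<close> outside \<open>T\<close>.\<close>

lemma ex1_extensional: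
  assumes "P (restrict f T)" "\<And>\<gamma> t. P \<gamma> \<Longrightarrow> t \<in> T \<Longrightarrow> \<gamma> t = f t"
  shows "\<exists>!\<gamma>. \<gamma> \<in> extensional T \<and> P \<gamma>"
proof (intro ex1I conjI)
  fix \<gamma> assume \<gamma>: "\<gamma> \<in> extensional T \<and> P \<gamma>"
  show "\<gamma> = restrict f T"
    by (rule extensionalityI[of _ T]) (use \<gamma> assms(2) in auto)
qed (auto simp: assms(1))

lemma geodesically_connectedI:
  fixes tr :: "'n::finite parallel_transport"
  assumes "\<And>m0 m1 S0 S1. posdef S0 \<Longrightarrow> posdef S1 \<Longrightarrow> \<exists>\<gamma>. geodesic_between tr (gaussian m0 S0) (gaussian m1 S1) \<gamma>"
  shows "geodesically_connected tr"
  using assms by (auto simp: geodesically_connected_def gaussians_def)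

lemma gderiv_quadratic_potential:
  fixes A :: "real^'n^'n"
  assumes "symmetric A"
  shows "GDERIV (\<lambda>x. x \<bullet> (A *v x) / 2 + b \<bullet> x) x :> A *v x + b"
proof -
  have A': "((\<lambda>x. A *v x) has_derivative (\<lambda>h. A *v h)) (at x)"
    by (rule bounded_linear_imp_has_derivative[OF matrix_vector_mul_bounded_linear])
  have "((\<lambda>x. x \<bullet> (A *v x)) has_derivative (\<lambda>h. x \<bullet> (A *v h) + h \<bullet> (A *v x))) (at x)"
    by (rule has_derivative_inner[OF has_derivative_ident A'])
  then have "((\<lambda>x. (1/2) * (x \<bullet> (A *v x)) + b \<bullet> x) has_derivative
      (\<lambda>h. (1/2) * (x \<bullet> (A *v h) + h \<bullet> (A *v x)) + b \<bullet> h)) (at x)"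
    by (intro has_derivative_add has_derivative_mult_right has_derivative_inner_right has_derivative_ident)
  moreover have "(1/2) * (x \<bullet> (A *v h) + h \<bullet> (A *v x)) + b \<bullet> h = h \<bullet> (A *v x + b)" for h
    using symmetric_inner[OF assms, of x h] by (simp add: inner_add_right inner_commute)
  ultimately show ?thesis
    by (simp add: gderiv_def)
qed

theorem proposition6:
  fixes m0 m1 b :: "real^'n" and S0 S1 R A :: "real^'n^'n"
    and f :: "real^'n \<Rightarrow> real" and P :: "real \<Rightarrow> real^'n^'n" and \<eta> :: "real \<Rightarrow> real^'n"
  assumes "posdef S0" and "posdef S1"
    and "R = matrix_inv (matrix_sqrt S0) ** matrix_sqrt (matrix_sqrt S0 ** S1 ** matrix_sqrt S0)
             ** matrix_inv (matrix_sqrt S0)"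
    and "A = matrix_log R"
    and "b = matrix_inv (int_exp 1 A) *v (m1 - R *v m0)"
    and "f = (\<lambda>x. x \<bullet> (A *v x) / 2 + b \<bullet> x)"
    and "P = (\<lambda>t. (1 - t) *\<^sub>R matrix_inv S0 + t *\<^sub>R matrix_inv S1)"
    and "\<eta> = (\<lambda>t. (1 - t) *\<^sub>R (matrix_inv S0 *v m0) + t *\<^sub>R (matrix_inv S1 *v m1))"
  shows
    "(\<exists>!\<gamma>. \<gamma> \<in> extensional {0..1} \<and>
        geodesic_between e1_transport (gaussian m0 S0) (gaussian m1 S1) \<gamma>) \<and>
     (\<exists>!\<gamma>. \<gamma> \<in> extensional {0..1} \<and>
        geodesic_between e0_transport (gaussian m0 S0) (gaussian m1 S1) \<gamma>) \<and>
     (\<forall>\<gamma>. geodesic_between e1_transport (gaussian m0 S0) (gaussian m1 S1) \<gamma> \<longrightarrow>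
        (\<forall>t\<in>{0..1}.
           \<gamma> t = gaussian (matrix_rpow R t *v m0 + int_exp t A *v b)
                          (matrix_rpow R t ** S0 ** matrix_rpow R t) \<and>
           e1_generator (\<gamma> t) (velocity {0..1} \<gamma> t) = (A, b))) \<and>
     (\<forall>x. GDERIV f x :> A *v x + b) \<and>
     (\<forall>\<gamma>. geodesic_between e0_transport (gaussian m0 S0) (gaussian m1 S1) \<gamma> \<longrightarrow>
        (\<forall>t\<in>{0..1}. \<gamma> t = gaussian (matrix_inv (P t) *v \<eta> t) (matrix_inv (P t)))) \<and>
     geodesically_connected (e1_transport :: 'n parallel_transport) \<and>
     geodesically_connected (e0_transport :: 'n parallel_transport) \<and>
     geodesically_complete (e1_transport :: 'n parallel_transport) \<and>
     \<not> geodesically_complete (e0_transport :: 'n parallel_transport) \<and>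
     geodesics_extend (e1_transport :: 'n parallel_transport) \<and>
     \<not> geodesics_extend (e0_transport :: 'n parallel_transport)"
proof -
  note S = assms(1,2)
  define \<gamma>1 where "\<gamma>1 = (\<lambda>t. gaussian (matrix_rpow R t *v m0 + int_exp t A *v b)
    (matrix_rpow R t ** S0 ** matrix_rpow R t))"
  define \<gamma>0 where "\<gamma>0 = (\<lambda>t. gaussian (matrix_inv (P t) *v \<eta> t) (matrix_inv (P t)))"
  have e1: "geodesic_between e1_transport (gaussian m0 S0) (gaussian m1 S1) (restrict \<gamma>1 {0..1})"
    unfolding \<gamma>1_def assms(3-5) by (rule e1_geodesic_between_exists[OF S])
  have e1_eq: "\<gamma> t = \<gamma>1 t" "e1_generator (\<gamma> t) (velocity {0..1} \<gamma> t) = (A, b)"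
    if "geodesic_between e1_transport (gaussian m0 S0) (gaussian m1 S1) \<gamma>" "t \<in> {0..1}" for \<gamma> t
    unfolding \<gamma>1_def assms(3-5) by (rule e1_geodesic_between_explicit[OF S that])+
  have e0: "geodesic_between e0_transport (gaussian m0 S0) (gaussian m1 S1) (restrict \<gamma>0 {0..1})"
    unfolding \<gamma>0_def assms(7,8) by (rule e0_geodesic_between_exists[OF S])
  have e0_eq: "\<gamma> t = \<gamma>0 t"
    if "geodesic_between e0_transport (gaussian m0 S0) (gaussian m1 S1) \<gamma>" "t \<in> {0..1}" for \<gamma> t
    unfolding \<gamma>0_def assms(7,8) by (rule e0_geodesic_between_explicit[OF S that])
  have "symmetric A"
    unfolding assms(3,4) by (rule matrix_log_posdef(1)[OF posdef_transport_matrix(1)[OF S]])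
  then have gradient: "GDERIV f x :> A *v x + b" for x
    unfolding assms(6) by (rule gderiv_quadratic_potential)
  have connected1: "geodesically_connected (e1_transport :: 'n parallel_transport)"
    by (rule geodesically_connectedI) (rule exI, rule e1_geodesic_between_exists)
  have connected0: "geodesically_connected (e0_transport :: 'n parallel_transport)"
    by (rule geodesically_connectedI) (rule exI, rule e0_geodesic_between_exists)
  show ?thesis
  proof (intro conjI allI impI ballI)
    show "\<exists>!\<gamma>. \<gamma> \<in> extensional {0..1} \<and>
        geodesic_between e1_transport (gaussian m0 S0) (gaussian m1 S1) \<gamma>"
      by (rule ex1_extensional) (rule e1, erule (1) e1_eq(1))
    show "\<exists>!\<gamma>. \<gamma> \<in> extensional {0..1} \<and>
        geodesic_between e0_transport (gaussian m0 S0) (gaussian m1 S1) \<gamma>"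
      by (rule ex1_extensional) (rule e0, erule (1) e0_eq)
  qed (rule e1_eq[unfolded \<gamma>1_def] e0_eq[unfolded \<gamma>0_def] gradient connected1 connected0
      e1_complete e0_not_complete e1_extend e0_not_extend; assumption)+
qed

end
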